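(* Let $\mathbb F$ be an algebraically closed field, $G$ a Cayley bigraph on a finite group $\mathcal G$, $L$ a subgraph of $G$, and $k$ an integer with $1\le k\le\rho(L)$. Then the generic maximum excess of $(L,G,\mathcal G,\mathbb F,k)$ is at most that of $(L,G,\mathcal G,\mathbb F,k-1)$, with equality if and only if both are zero.
   Context: Cayley bigraph on $\mathcal G$ with generators $g_1,g_2$: $V_G=\mathcal G$, $E_G=\mathcal G\times\{1,2\}$, edge $(g,i)$ has tail $g$, head $g_ig$. For $x\in\mathcal G$ and a subgraph $L$, $Lx$ is the image of $L$ under $g\mapsto gx$, $(g,i)\mapsto(gx,i)$; for $P\in V_G\sqcup E_G$, $\mathcal G_L(P)=\{x\in\mathcal G:P\in Lx\}$. For $k\ge0$ and $M\in\mathbb F^{k\times\mathcal G}$ with columns $m^x$, $M$ is $L$-surjective if for every $P$ the columns $m^x$, $x\in\mathcal G_L(P)$, span $\mathbb F^k$; then $\mathcal K_M(L)$ is the sheaf on $G$ with $\mathcal K_M(L)(P)=\{a\in\mathbb F^{\mathcal G}:a_x=0\ \forall x\notin\mathcal G_L(P),\ \sum_xa_xm^x=0\}$ and restriction maps the inclusions. The generic maximum excess of $(L,G,\mathcal G,\mathbb F,k)$ (for $k\le\rho(L)$) is the largest integer $m$ such that the set of $L$-surjective $M\in\mathbb F^{k\times\mathcal G}$ with ${\rm m.e.}(\mathcal K_M(L))\ge m$ is Zariski dense in $\mathbb F^{k\times\mathcal G}$. Maximum excess of a sheaf $\mathcal F$: with $\mathcal F(V)=\bigoplus_v\mathcal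 F(v)$, $d_h,d_t$ sending $\mathcal F(e)$ into $\mathcal F(he)$, $\mathcal F(te)$ by the restriction maps, $\Gamma_{\rm ht}(U)=\bigoplus_e\{w\in\mathcal F(e):d_hw,d_tw\in U\}$ and ${\rm m.e.}(\mathcal F)=\max_{U\subset\mathcal F(V)}(\dim\Gamma_{\rm ht}(U)-\dim U)$. $\rho(L)=\sum_X\max(0,|E_X|-|V_X|)$ over connected components $X$ of $L$ as an undirected graph. *)

theory Defs
  imports "HOL-Algebra.Group" "HOL-Computational_Algebra.Polynomial"
    "HOL-Library.Function_Algebras"
begin

definition alg_closed :: "'f::field itself \<Rightarrow> bool" where
  "alg_closed _ \<longleftrightarrow> (\<forall>p::'f poly. degree p > 0 \<longrightarrow> (\<exists>x. poly p x = 0))"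

text \<open>Cayley bigraph on the group G with generators g1 g2:
  vertices = carrier G, edges = carrier G \<times> {1,2}, edge (g,i) has tail g and head g_i g.\<close>
definition cay_edges :: "('g, 'b) monoid_scheme \<Rightarrow> ('g \<times> nat) set" where
  "cay_edges G = carrier G \<times> {1, 2}"

definition cay_tail :: "'g \<times> nat \<Rightarrow> 'g" where
  "cay_tail e = fst e"

definition cay_head :: "('g, 'b) monoid_scheme \<Rightarrow> 'g \<Rightarrow> 'g \<Rightarrow> 'g \<times> nat \<Rightarrow> 'g" where
  "cay_head G g1 g2 e = (if snd e = 1 then g1 else g2) \<otimes>\<^bsub>G\<^esub> fst e"

definition is_subgraph ::
  "('g, 'b) monoid_scheme \<Rightarrow> 'g \<Rightarrow> 'g \<Rightarrow> 'g set \<times> ('g \<times> nat) set \<Rightarrow> bool" where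
  "is_subgraph G g1 g2 L \<longleftrightarrow> fst L \<subseteq> carrier G \<and> snd L \<subseteq> cay_edges G \<and>
     (\<forall>e\<in>snd L. cay_tail e \<in> fst L \<and> cay_head G g1 g2 e \<in> fst L)"

definition translate ::
  "('g, 'b) monoid_scheme \<Rightarrow> 'g set \<times> ('g \<times> nat) set \<Rightarrow> 'g \<Rightarrow> 'g set \<times> ('g \<times> nat) set" where
  "translate G L x = ((\<lambda>g. g \<otimes>\<^bsub>G\<^esub> x) ` fst L, (\<lambda>(g, i). (g \<otimes>\<^bsub>G\<^esub> x, i)) ` snd L)"

definition gpoints :: "('g, 'b) monoid_scheme \<Rightarrow> ('g + 'g \<times> nat) set" where
  "gpoints G = Inl ` carrier G \<union> Inr ` cay_edges G"

definition in_graph :: "'g + 'g \<times> nat \<Rightarrow> 'g set \<times> ('g \<times> nat) set \<Rightarrow> bool" where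
  "in_graph P L = (case P of Inl v \<Rightarrow> v \<in> fst L | Inr e \<Rightarrow> e \<in> snd L)"

definition GL :: "('g, 'b) monoid_scheme \<Rightarrow> 'g set \<times> ('g \<times> nat) set \<Rightarrow> 'g + 'g \<times> nat \<Rightarrow> 'g set" where
  "GL G L P = {x \<in> carrier G. in_graph P (translate G L x)}"

definition fscale :: "'f::field \<Rightarrow> ('a \<Rightarrow> 'f) \<Rightarrow> ('a \<Rightarrow> 'f)" where
  "fscale c f = (\<lambda>x. c * f x)"

definition fscale2 :: "'f::field \<Rightarrow> ('a \<Rightarrow> 'c \<Rightarrow> 'f) \<Rightarrow> ('a \<Rightarrow> 'c \<Rightarrow> 'f)" where
  "fscale2 c F = (\<lambda>v. fscale c (F v))"

text \<open>Matrices M \<in> \<FF>^{k\<times>\<G>} are functions on index pairs (i,x), i<k, x\<in>\<G>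
  (and zero elsewhere); the column m^x is \<lambda>i. M (i,x).\<close>
definition mat_index :: "nat \<Rightarrow> ('g, 'b) monoid_scheme \<Rightarrow> (nat \<times> 'g) set" where
  "mat_index k G = {0..<k} \<times> carrier G"

definition column :: "(nat \<times> 'g \<Rightarrow> 'f) \<Rightarrow> 'g \<Rightarrow> nat \<Rightarrow> 'f" where
  "column M x = (\<lambda>i. M (i, x))"

definition affine_points :: "'v set \<Rightarrow> ('v \<Rightarrow> 'f::zero) set" where
  "affine_points I = {p. \<forall>v. v \<notin> I \<longrightarrow> p v = 0}"

inductive_set poly_funs :: "'v set \<Rightarrow> (('v \<Rightarrow> 'f::comm_ring_1) \<Rightarrow> 'f) set" for I where
  pf_const: "(\<lambda>p. c) \<in> poly_funs I"
| pf_var: "v \<in> I \<Longrightarrow> (\<lambda>p. p v) \<in> poly_funs I"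
| pf_add: "f \<in> poly_funs I \<Longrightarrow> g \<in> poly_funs I \<Longrightarrow> (\<lambda>p. f p + g p) \<in> poly_funs I"
| pf_mult: "f \<in> poly_funs I \<Longrightarrow> g \<in> poly_funs I \<Longrightarrow> (\<lambda>p. f p * g p) \<in> poly_funs I"

definition zariski_dense :: "'v set \<Rightarrow> ('v \<Rightarrow> 'f::comm_ring_1) set \<Rightarrow> bool" where
  "zariski_dense I S \<longleftrightarrow> S \<subseteq> affine_points I \<and>
     (\<forall>f\<in>poly_funs I. (\<forall>p\<in>S. f p = 0) \<longrightarrow> (\<forall>p\<in>affine_points I. f p = 0))"

definition L_surjective ::
  "('g, 'b) monoid_scheme \<Rightarrow> 'g set \<times> ('g \<times> nat) set \<Rightarrow> nat \<Rightarrow> (nat \<times> 'g \<Rightarrow> 'f::field) \<Rightarrow> bool" where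
  "L_surjective G L k M \<longleftrightarrow>
     (\<forall>P\<in>gpoints G. module.span fscale (column M ` GL G L P) = affine_points {0..<k})"

text \<open>The sheaf \<K>_M(L): value at each point P (restriction maps are inclusions).\<close>
definition KML ::
  "('g, 'b) monoid_scheme \<Rightarrow> 'g set \<times> ('g \<times> nat) set \<Rightarrow> nat \<Rightarrow> (nat \<times> 'g \<Rightarrow> 'f::field)
     \<Rightarrow> 'g + 'g \<times> nat \<Rightarrow> ('g \<Rightarrow> 'f) set" where
  "KML G L k M P = {a. (\<forall>x. x \<notin> GL G L P \<longrightarrow> a x = 0) \<and>
      (\<forall>i<k. (\<Sum>x\<in>carrier G. a x * M (i, x)) = 0)}"

text \<open>Maximum excess of a sheaf F on the Cayley bigraph whose restriction maps are inclusions
  F(e) \<subseteq> F(he), F(e) \<subseteq> F(te); here F(P) \<subseteq> \<FF>^\<G>.\<close>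
definition sheaf_FV :: "('g, 'b) monoid_scheme \<Rightarrow> ('g + 'g \<times> nat \<Rightarrow> ('g \<Rightarrow> 'f::field) set)
     \<Rightarrow> ('g \<Rightarrow> 'g \<Rightarrow> 'f) set" where
  "sheaf_FV G F = {\<Phi>. (\<forall>v\<in>carrier G. \<Phi> v \<in> F (Inl v)) \<and> (\<forall>v. v \<notin> carrier G \<longrightarrow> \<Phi> v = 0)}"

text \<open>d_h w and d_t w: w placed in the summand F(he), resp. F(te), of F(V).\<close>
definition place :: "'g \<Rightarrow> ('g \<Rightarrow> 'f::zero) \<Rightarrow> ('g \<Rightarrow> 'g \<Rightarrow> 'f)" where
  "place v w = (\<lambda>u. if u = v then w else 0)"

definition Gamma_ht :: "('g, 'b) monoid_scheme \<Rightarrow> 'g \<Rightarrow> 'g \<Rightarrow> ('g + 'g \<times> nat \<Rightarrow> ('g \<Rightarrow> 'f::field) set)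
     \<Rightarrow> ('g \<Rightarrow> 'g \<Rightarrow> 'f) set \<Rightarrow> ('g \<times> nat \<Rightarrow> 'g \<Rightarrow> 'f) set" where
  "Gamma_ht G g1 g2 F U = {W. (\<forall>e\<in>cay_edges G. W e \<in> F (Inr e) \<and>
        place (cay_head G g1 g2 e) (W e) \<in> U \<and> place (cay_tail e) (W e) \<in> U) \<and>
      (\<forall>e. e \<notin> cay_edges G \<longrightarrow> W e = 0)}"

definition max_excess :: "('g, 'b) monoid_scheme \<Rightarrow> 'g \<Rightarrow> 'g \<Rightarrow> ('g + 'g \<times> nat \<Rightarrow> ('g \<Rightarrow> 'f::field) set)
     \<Rightarrow> int" where
  "max_excess G g1 g2 F = Max {int (vector_space.dim fscale2 (Gamma_ht G g1 g2 F U))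
       - int (vector_space.dim fscale2 U) | U. module.subspace fscale2 U \<and> U \<subseteq> sheaf_FV G F}"

definition adj_rel :: "('g, 'b) monoid_scheme \<Rightarrow> 'g \<Rightarrow> 'g \<Rightarrow> 'g set \<times> ('g \<times> nat) set \<Rightarrow> ('g \<times> 'g) set" where
  "adj_rel G g1 g2 L = {(u, v). \<exists>e\<in>snd L.
      (cay_tail e = u \<and> cay_head G g1 g2 e = v) \<or> (cay_tail e = v \<and> cay_head G g1 g2 e = u)}"

definition components :: "('g, 'b) monoid_scheme \<Rightarrow> 'g \<Rightarrow> 'g \<Rightarrow> 'g set \<times> ('g \<times> nat) set \<Rightarrow> 'g set set" where
  "components G g1 g2 L = {{v\<in>fst L. (u, v) \<in> (adj_rel G g1 g2 L)\<^sup>*} | u. u \<in> fst L}"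

definition rho :: "('g, 'b) monoid_scheme \<Rightarrow> 'g \<Rightarrow> 'g \<Rightarrow> 'g set \<times> ('g \<times> nat) set \<Rightarrow> nat" where
  "rho G g1 g2 L = (\<Sum>C\<in>components G g1 g2 L.
      nat (int (card {e\<in>snd L. cay_tail e \<in> C}) - int (card C)))"

definition gen_max_excess :: "'f::field itself \<Rightarrow> ('g, 'b) monoid_scheme \<Rightarrow> 'g \<Rightarrow> 'g
     \<Rightarrow> 'g set \<times> ('g \<times> nat) set \<Rightarrow> nat \<Rightarrow> int" where
  "gen_max_excess TYPE('f) G g1 g2 L k = (GREATEST m::int.
     zariski_dense (mat_index k G)
       {M :: nat \<times> 'g \<Rightarrow> 'f. M \<in> affine_points (mat_index k G) \<and> L_surjective G L k M \<and>
          m \<le> max_excess G g1 g2 (KML G L k M)})"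

end

(* The maximum excess is semicontinuous: if m.e.(K_M) >= m for a Zariski dense set of matrices M, then
   for all of them.  Hence the generic maximum excess is the minimum of m.e.(K_M) over all M, L-surjective
   or not.  Take M attaining the minimum m for k - 1 and suppose m > 0.  The maximizers U for M form a
   lattice (the excess is supermodular), so there is a least one; it is nonzero, and a new row which does
   not annihilate it produces a matrix with k rows and maximum excess less than m.

   Semicontinuity comes from a valuative argument.  A Zariski dense set S and a point p give a
   specialization homomorphism from the restrictions to S of polynomial functions to the field, f |-> f(p).
   Because the field is algebraically closed, a maximal extension of it to a subalgebra of all functions on
   S behaves like a valuation ring, so that families of subspaces indexed by S have limits of the same
   dimension. *)
theory Submission
  imports Defs
begin

section \<open>Dimension in finitely spanned subspaces\<close>

text \<open>The obstacle is that the maximizing subspaces for the matrices of S come from choice: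
  nothing makes them vary algebraically with the matrix, and no equations for the condition m.e. >=
  m are at hand. Working in the ring of all functions on S removes it, since any chosen family has
  coordinates there; the argument is the valuative form of the properness of Grassmannians. The
  price is a ring with zero divisors, so that "x or 1/x has a limit" has to be proved with indicator
  functions where a field would offer inverses. Limits suffice because the dimension of U is kept,
  while the conditions on a head-tail section are equations that pass to the limit; hence the excess
  cannot drop at the limit point. The same device, applied to row vectors that annihilate columns,
  shows that L-surjective matrices are dense, and this is where k \<le> rho(L) enters. The weak
  inequality of the theorem comes from appending a zero row, which leaves the sheaf
  unchanged.\<close>

lemma (in vector_space) dim_mono_finite:
  assumes "finite T" "Y \<subseteq> span T" "X \<subseteq> span Y"
  shows "dim X \<le> dim Y"
proof -
  obtain B where B: "B \<subseteq> Y" "independent B" "Y \<subseteq> span B" "card B = dim Y"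
    using basis_exists by blast
  have "finite B"
    using independent_span_bound[of T B] B assms by blast
  moreover have "X \<subseteq> span B"
    using assms(3) B(3) span_minimal[OF B(3) subspace_span] by blast
  ultimately show ?thesis
    using dim_le_card[of X B] B(4) by simp
qed

text \<open>The ambient function spaces can be infinite-dimensional, and \<open>card\<close> is 0 on
  infinite sets. The finite spanning set \<open>T\<close>, here and below, keeps \<open>dim\<close>
  a true dimension.\<close>

lemma (in vector_space) independent_card_le_dim_finite:
  assumes "finite T" "Y \<subseteq> span T" "independent B" "B \<subseteq> Y"
  shows "finite B" "card B \<le> dim Y"
proof -
  show "finite B"
    using independent_span_bound[of T B] assms by blast
  have "dim B \<le> dim Y"
    using dim_mono_finite[of T Y B] assms span_superset by blast
  then show "card B \<le> dim Y"
    using dim_eq_card_independent assms by simp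
qed

text \<open>A basis \<open>B\<close> of the intersection is extended to bases \<open>C\<close> and
  \<open>D\<close>. In a relation on \<open>C \<union> (D - B)\<close> the part from
  \<open>D - B\<close> is minus the part from \<open>C\<close>, so it lies in the intersection and
  thus in the span of \<open>B\<close>. Independence of \<open>D\<close> kills its coefficients,
  then independence of \<open>C\<close> kills the others.\<close>

lemma (in vector_space) dim_sums_Int_finite:
  assumes T: "finite T" "S \<subseteq> span T" "U \<subseteq> span T" and S: "subspace S" and U: "subspace U"
  shows "dim {x + y |x y. x \<in> S \<and> y \<in> U} + dim (S \<inter> U) = dim S + dim U"
proof -
  obtain B where B: "B \<subseteq> S \<inter> U" "independent B" "S \<inter> U \<subseteq> span B" "card B = dim (S \<inter> U)"
    using basis_exists by blast
  obtain C where C: "B \<subseteq> C" "C \<subseteq> S" "independent C" "S \<subseteq> span C"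
    using maximal_independent_subset_extend[of B S] B by blast
  obtain D where D: "B \<subseteq> D" "D \<subseteq> U" "independent D" "U \<subseteq> span D"
    using maximal_independent_subset_extend[of B U] B by blast
  have fin: "finite C" "finite D"
    using independent_card_le_dim_finite(1)[OF T(1)] T C D by blast+
  then have "finite B"
    using C(1) finite_subset by blast
  have dS: "dim S = card C" and dU: "dim U = card D"
    using basis_card_eq_dim C D by metis+
  have CD: "C \<inter> D = B"
  proof
    show "B \<subseteq> C \<inter> D" using C D by blast
    show "C \<inter> D \<subseteq> B"
    proof
      fix x assume x: "x \<in> C \<inter> D"
      then have xs: "x \<in> span B" using C D B by blast
      show "x \<in> B"
      proof (rule ccontr)
        assume "x \<notin> B"
        then have "B \<subseteq> C - {x}" using C by blast
        then have "x \<in> span (C - {x})" using xs span_mono by blast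
        then show False using C(3) x dependent_def by blast
      qed
    qed
  qed
  have ind: "independent (C \<union> (D - B))"
  proof (rule independent_if_scalars_zero)
    show "finite (C \<union> (D - B))" using fin by blast
    fix f x assume sum0: "(\<Sum>x\<in>C \<union> (D - B). f x *s x) = 0" and x: "x \<in> C \<union> (D - B)"
    define c where "c = (\<Sum>x\<in>C. f x *s x)"
    define d where "d = (\<Sum>x\<in>D - B. f x *s x)"
    have cd: "c + d = 0"
      unfolding c_def d_def using sum0 CD fin
      by (subst sum.union_disjoint[symmetric]) auto
    have cS: "c \<in> S"
      unfolding c_def using C by (intro subspace_sum[OF S] subspace_scale[OF S]) auto
    have dU: "d \<in> U"
      unfolding d_def using D by (intro subspace_sum[OF U] subspace_scale[OF U]) auto
    have "d = - c"
      using cd by (simp add: eq_neg_iff_add_eq_0 add.commute)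
    then have "d \<in> span B"
      using cS dU B(3) subspace_neg[OF S] by blast
    then obtain g where g: "d = (\<Sum>x\<in>B. g x *s x)"
      using span_finite[OF \<open>finite B\<close>] by auto
    have "(\<Sum>x\<in>D. (if x \<in> B then - g x else f x) *s x) = 0"
    proof -
      have "(\<Sum>x\<in>D. (if x \<in> B then - g x else f x) *s x)
          = (\<Sum>x\<in>D - B. (if x \<in> B then - g x else f x) *s x)
            + (\<Sum>x\<in>B. (if x \<in> B then - g x else f x) *s x)"
        using sum.subset_diff[OF D(1) fin(2)] by blast
      also have "\<dots> = d - d"
        using g by (simp add: d_def sum_negf)
      finally show ?thesis by simp
    qed
    moreover have indD: "\<And>u. (\<Sum>x\<in>D. u x *s x) = 0 \<Longrightarrow> \<forall>x\<in>D. u x = 0"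
      using D(3) fin(2) unfolding independent_explicit_finite_subsets by blast
    ultimately have "\<forall>x\<in>D. (if x \<in> B then - g x else f x) = 0"
      using indD[of "\<lambda>x. if x \<in> B then - g x else f x"] by simp
    then have fD: "\<forall>x\<in>D - B. f x = 0" by auto
    then have "d = 0" unfolding d_def by simp
    then have "c = 0" using cd by simp
    then have "\<forall>x\<in>C. f x = 0"
      using C(3) fin(1) unfolding independent_explicit_finite_subsets c_def by blast
    then show "f x = 0" using fD x by blast
  qed
  have "dim {x + y |x y. x \<in> S \<and> y \<in> U} = card (C \<union> (D - B))"
  proof (rule dim_unique[OF _ _ ind refl])
    show "C \<union> (D - B) \<subseteq> {x + y |x y. x \<in> S \<and> y \<in> U}"
    proof
      fix x assume "x \<in> C \<union> (D - B)"
      then have "x \<in> S \<or> x \<in> U" using C D by blast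
      moreover have "x = x + 0" "x = 0 + x" by simp_all
      ultimately show "x \<in> {x + y |x y. x \<in> S \<and> y \<in> U}"
        using subspace_0[OF S] subspace_0[OF U] by blast
    qed
    have "C \<subseteq> span (C \<union> (D - B))" "D \<subseteq> span (C \<union> (D - B))"
      using C(1) span_superset[of "C \<union> (D - B)"] by blast+
    then have "S \<subseteq> span (C \<union> (D - B))" "U \<subseteq> span (C \<union> (D - B))"
      using C(4) D(4) span_minimal[OF _ subspace_span] by blast+
    then show "{x + y |x y. x \<in> S \<and> y \<in> U} \<subseteq> span (C \<union> (D - B))"
      using span_add by blast
  qed
  also have "\<dots> = card C + card (D - B)"
    using fin CD by (intro card_Un_disjoint) auto
  also have "card (D - B) = card D - card B"
    using \<open>finite B\<close> D(1) by (simp add: card_Diff_subset)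
  finally show ?thesis
    using dS dU B(4) card_mono[OF fin(2) D(1)] by simp
qed

text \<open>The family is indexed because vectors may coincide. A repetition gives the relation
  \<open>f i - f j = 0\<close>; an injective family is a set too large to be independent.\<close>

lemma (in vector_space) family_dependent:
  assumes T: "finite T" "U \<subseteq> span T" and I: "finite I" "\<And>i. i \<in> I \<Longrightarrow> f i \<in> U" "dim U < card I"
  shows "\<exists>c. (\<exists>i\<in>I. c i \<noteq> 0) \<and> (\<Sum>i\<in>I. c i *s f i) = 0"
proof (cases "inj_on f I")
  case True
  have "dependent (f ` I)"
    using independent_card_le_dim_finite(2)[OF T, of "f ` I"] I card_image[OF True] by force
  then obtain u v where u: "v \<in> f ` I" "u v \<noteq> 0" "(\<Sum>v\<in>f ` I. u v *s v) = 0"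
    using dependent_finite[of "f ` I"] I(1) by blast
  have "(\<Sum>i\<in>I. u (f i) *s f i) = 0"
    using u(3) by (simp add: sum.reindex[OF True])
  then show ?thesis
    using u by (intro exI[of _ "\<lambda>i. u (f i)"]) auto
next
  case False
  then obtain i j where ij: "i \<in> I" "j \<in> I" "i \<noteq> j" "f i = f j"
    unfolding inj_on_def by blast
  define c where "c = (\<lambda>l. if l = i then 1 else if l = j then - 1 else 0 :: 'a)"
  have "(\<Sum>l\<in>I. c l *s f l) = (\<Sum>l\<in>{i, j}. c l *s f l)"
    using ij I(1) by (intro sum.mono_neutral_right) (auto simp: c_def)
  also have "\<dots> = 0"
    using ij by (simp add: c_def)
  finally show ?thesis
    using ij(1) by (intro exI[of _ c]) (auto simp: c_def)
qed

text \<open>If \<open>h\<close> does not vanish at \<open>x\<close>, every vector of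
  \<open>U\<close> is a multiple of \<open>x\<close> plus a vector of the kernel.\<close>

lemma (in vector_space) dim_kernel_functional:
  assumes T: "finite T" "U \<subseteq> span T" and U: "subspace U"
    and add: "\<And>x y. h (x + y) = h x + h y" and scale: "\<And>c x. h (c *s x) = c * h x"
  shows "dim U \<le> Suc (dim {x \<in> U. h x = 0})"
proof -
  obtain B where B: "B \<subseteq> {x \<in> U. h x = 0}" "independent B" "{x \<in> U. h x = 0} \<subseteq> span B"
      "card B = dim {x \<in> U. h x = 0}"
    using basis_exists by blast
  have finB: "finite B"
    using independent_card_le_dim_finite(1)[OF T B(2)] B(1) by blast
  show ?thesis
  proof (cases "\<exists>x\<in>U. h x \<noteq> 0")
    case True
    then obtain x where x: "x \<in> U" "h x \<noteq> 0" by blast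
    have "U \<subseteq> span (insert x B)"
    proof
      fix y assume y: "y \<in> U"
      define w where "w = y + (- (h y / h x)) *s x"
      have "w \<in> U"
        unfolding w_def using y x U by (intro subspace_add subspace_scale) auto
      moreover have "h w = 0"
        unfolding w_def add scale using x by simp
      ultimately have "w \<in> span (insert x B)"
        using B(3) span_mono[of B "insert x B"] by blast
      moreover have "(h y / h x) *s x \<in> span (insert x B)"
        by (intro span_scale span_base) simp
      moreover have "y = w + (h y / h x) *s x"
        unfolding w_def by simp
      ultimately show "y \<in> span (insert x B)"
        using span_add by metis
    qed
    then have "dim U \<le> card (insert x B)"
      using dim_le_card finB by blast
    then show ?thesis
      using B(4) card_insert_le_m1[of "Suc (card B)" B x] by simp
  next
    case False
    then have "{x \<in> U. h x = 0} = U" by blast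
    then show ?thesis by simp
  qed
qed

lemma (in vector_space) dim_less_finite:
  assumes T: "finite T" "U \<subseteq> span T" and W: "subspace W" "W \<subseteq> U" and x: "x \<in> U" "x \<notin> W"
  shows "dim W < dim U"
proof -
  obtain B where B: "B \<subseteq> W" "independent B" "W \<subseteq> span B" "card B = dim W"
    by (rule basis_exists)
  have "span B \<subseteq> W" using B(1) W(1) by (rule span_minimal)
  then have xB: "x \<notin> span B" using x(2) by blast
  have "x \<notin> B" using B(1) x(2) by blast
  have BU: "insert x B \<subseteq> U" using B(1) W(2) x(1) by blast
  have ind: "independent (insert x B)" using xB B(2) by (rule independent_insertI)
  have "finite (insert x B)" "card (insert x B) \<le> dim U"
    using independent_card_le_dim_finite[OF T ind BU] by blast+
  then show ?thesis using \<open>x \<notin> B\<close> B(4) by simp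
qed

section \<open>Limit algebras\<close>

text \<open>Functions on a set of points with a distinguished point \<^term>\<open>z\<close>. The last axiom makes evaluation
  at \<^term>\<open>z\<close> a homomorphism on the restrictions to the other points: the value at \<^term>\<open>z\<close> is the limit
  of the function.\<close>
locale limit_algebra =
  fixes z :: 't and H :: "('t \<Rightarrow> 'f::field) set"
  assumes const: "(\<lambda>_. c) \<in> H"
    and add: "f \<in> H \<Longrightarrow> g \<in> H \<Longrightarrow> (\<lambda>s. f s + g s) \<in> H"
    and mult: "f \<in> H \<Longrightarrow> g \<in> H \<Longrightarrow> (\<lambda>s. f s * g s) \<in> H"
    and limit_zero: "f \<in> H \<Longrightarrow> (\<And>s. s \<noteq> z \<Longrightarrow> f s = 0) \<Longrightarrow> f z = 0"
begin

lemma uminus: "f \<in> H \<Longrightarrow> (\<lambda>s. - f s) \<in> H"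
  using mult[OF const[of "- 1"]] by force

lemma diff: "f \<in> H \<Longrightarrow> g \<in> H \<Longrightarrow> (\<lambda>s. f s - g s) \<in> H"
  using add[OF _ uminus] by force

lemma sum: "finite A \<Longrightarrow> (\<And>i. i \<in> A \<Longrightarrow> f i \<in> H) \<Longrightarrow> (\<lambda>s. \<Sum>i\<in>A. f i s) \<in> H"
  by (induction A rule: finite_induct) (auto intro: add const)

lemma power: "f \<in> H \<Longrightarrow> (\<lambda>s. f s ^ n) \<in> H"
  by (induction n) (auto intro: mult const)

lemma limit_eq: "f \<in> H \<Longrightarrow> g \<in> H \<Longrightarrow> (\<And>s. s \<noteq> z \<Longrightarrow> f s = g s) \<Longrightarrow> f z = g z"
  using limit_zero[OF diff, of f g] by simp

text \<open>This is the polynomial ring H[X], each element stored as its family of specializations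
  at the points. The uniform degree bound excludes power series with coefficients in
  \<open>H\<close> that happen to be finite at each point.\<close>

definition poly_sections :: "('t \<Rightarrow> 'f poly) set" where
  "poly_sections = {P. (\<forall>i. (\<lambda>s. coeff (P s) i) \<in> H) \<and> (\<exists>n. \<forall>s. degree (P s) \<le> n)}"

lemma poly_sections_const: "(\<lambda>_. q) \<in> poly_sections"
  unfolding poly_sections_def by (auto intro: const)

lemma poly_sections_add:
  assumes "P \<in> poly_sections" "Q \<in> poly_sections"
  shows "(\<lambda>s. P s + Q s) \<in> poly_sections"
proof -
  obtain m n where "\<And>s. degree (P s) \<le> m" "\<And>s. degree (Q s) \<le> n"
    using assms unfolding poly_sections_def by blast
  then have "\<forall>s. degree (P s + Q s) \<le> max m n"
    by (meson degree_add_le max.coboundedI1 max.coboundedI2)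
  then show ?thesis
    using assms unfolding poly_sections_def by (auto intro: add)
qed

lemma poly_sections_mult:
  assumes "P \<in> poly_sections" "Q \<in> poly_sections"
  shows "(\<lambda>s. P s * Q s) \<in> poly_sections"
proof -
  obtain m n where "\<And>s. degree (P s) \<le> m" "\<And>s. degree (Q s) \<le> n"
    using assms unfolding poly_sections_def by blast
  then have "\<forall>s. degree (P s * Q s) \<le> m + n"
    by (meson add_mono degree_mult_le order_trans)
  then show ?thesis
    using assms unfolding poly_sections_def
    by (auto simp: coeff_mult intro!: sum mult)
qed

lemma poly_sections_coeff:
  assumes "f \<in> H"
  shows "(\<lambda>s. [:f s:]) \<in> poly_sections"
proof -
  have "(\<lambda>s. coeff [:f s:] i) \<in> H" for i
    using assms const by (cases i) auto
  then show ?thesis unfolding poly_sections_def by auto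
qed

lemma poly_sections_monom:
  assumes "f \<in> H"
  shows "(\<lambda>s. monom (f s) n) \<in> poly_sections"
  using poly_sections_mult[OF poly_sections_coeff[OF assms] poly_sections_const[of "monom 1 n"]]
  by (simp add: smult_monom)

lemma poly_sections_sum:
  "finite A \<Longrightarrow> (\<And>i. i \<in> A \<Longrightarrow> P i \<in> poly_sections) \<Longrightarrow> (\<lambda>s. \<Sum>i\<in>A. P i s) \<in> poly_sections"
  by (induction A rule: finite_induct) (auto intro: poly_sections_add poly_sections_const)

lemma poly_sections_eval:
  assumes "P \<in> poly_sections" "f \<in> H"
  shows "(\<lambda>s. poly (P s) (f s)) \<in> H"
proof -
  obtain n where n: "\<And>s. degree (P s) \<le> n"
    using assms unfolding poly_sections_def by blast
  have "poly (P s) (f s) = (\<Sum>i\<le>n. coeff (P s) i * f s ^ i)" for s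
    using n[of s] unfolding poly_altdef
    by (intro sum.mono_neutral_left) (auto simp: coeff_eq_0)
  moreover have "(\<lambda>s. coeff (P s) i) \<in> H" for i
    using assms unfolding poly_sections_def by blast
  ultimately show ?thesis
    using assms by (auto intro!: sum mult power)
qed

end

section \<open>Maximal limit algebras behave like valuation rings\<close>

locale maximal_limit_algebra = limit_algebra +
  assumes alg_closed: "alg_closed TYPE('b)"
    and maximal: "limit_algebra z H' \<Longrightarrow> H \<subseteq> H' \<Longrightarrow> H' = H"
begin

text \<open>The possible limits of \<open>x\<close> are the common roots of \<open>J\<close>, the
  ideal of those polynomials over the field that arise at \<open>z\<close> from relations satisfied
  by \<open>x\<close> at all other points. A proper ideal is zero or generated by a non-constant
  polynomial, which has a root; adjoining \<open>x\<close> with this value then stays inside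
  \<open>H\<close> by maximality. An improper ideal contains 1, which is the obstruction.\<close>

lemma extension_cases:
  obtains (extends) a where "x(z := a) \<in> H"
  | (obstructed) P where "P \<in> poly_sections" "P z = 1" "\<And>s. s \<noteq> z \<Longrightarrow> poly (P s) (x s) = 0"
proof (cases "\<exists>P\<in>poly_sections. P z = 1 \<and> (\<forall>s. s \<noteq> z \<longrightarrow> poly (P s) (x s) = 0)")
  case True
  then show ?thesis using obstructed by blast
next
  case False
  define J where "J = {P z |P. P \<in> poly_sections \<and> (\<forall>s. s \<noteq> z \<longrightarrow> poly (P s) (x s) = 0)}"
  have J1: "1 \<notin> J" using False unfolding J_def by force
  have J_I: "P z \<in> J" if "P \<in> poly_sections" "\<And>s. s \<noteq> z \<Longrightarrow> poly (P s) (x s) = 0" for P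
    using that unfolding J_def by auto
  have J_E: "\<exists>P. p = P z \<and> P \<in> poly_sections \<and> (\<forall>s. s \<noteq> z \<longrightarrow> poly (P s) (x s) = 0)"
    if "p \<in> J" for p
    using that unfolding J_def by (rule CollectD)
  have J_add: "p + q \<in> J" if "p \<in> J" "q \<in> J" for p q
  proof -
    from J_E[OF that(1)] J_E[OF that(2)] obtain P Q where
      "p = P z" "P \<in> poly_sections" "\<forall>s. s \<noteq> z \<longrightarrow> poly (P s) (x s) = 0"
      "q = Q z" "Q \<in> poly_sections" "\<forall>s. s \<noteq> z \<longrightarrow> poly (Q s) (x s) = 0"
      by (elim exE conjE)
    then show ?thesis using J_I[OF poly_sections_add[of P Q]] by simp
  qed
  have J_mult: "q * p \<in> J" if "p \<in> J" for p q
  proof -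
    from J_E[OF that] obtain P where
      "p = P z" "P \<in> poly_sections" "\<forall>s. s \<noteq> z \<longrightarrow> poly (P s) (x s) = 0"
      by (elim exE conjE)
    then show ?thesis
      using J_I[OF poly_sections_mult[OF poly_sections_const, of P q]] by simp
  qed
  have "\<exists>a. \<forall>q\<in>J. poly q a = 0"
  proof (cases "J \<subseteq> {0}")
    case True
    then have "\<forall>q\<in>J. poly q 0 = 0" by auto
    then show ?thesis by blast
  next
    case False
    \<comment> \<open>A nonzero element of least degree generates \<open>J\<close>; it is not
      constant because 1 is not in \<open>J\<close>.\<close>
    then obtain d where d: "d \<in> J" "d \<noteq> 0" and min: "\<And>q. q \<in> J \<Longrightarrow> q \<noteq> 0 \<Longrightarrow> degree d \<le> degree q"
      using ex_has_least_nat[of "\<lambda>q. q \<in> J \<and> q \<noteq> 0" _ degree] by blast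
    have "degree d > 0"
    proof (rule ccontr)
      assume "\<not> degree d > 0"
      then obtain c where c: "d = [:c:]" using degree_eq_zeroE by blast
      then have "[:inverse c:] * d = 1" using d by (auto simp: one_pCons)
      then show False using J_mult[OF d(1)] J1 by metis
    qed
    then obtain a where a: "poly d a = 0"
      using alg_closed unfolding alg_closed_def by blast
    have "poly q a = 0" if "q \<in> J" for q
    proof -
      have "q mod d = q + (- (q div d)) * d"
        by (simp add: minus_div_mult_eq_mod[symmetric])
      then have "q mod d \<in> J" using J_add J_mult that d by metis
      then have "q mod d = 0"
        using min[of "q mod d"] degree_mod_less[of d q] d by fastforce
      then have "d dvd q" by auto
      then show ?thesis using a by (auto elim: dvdE)
    qed
    then show ?thesis by blast
  qed
  then obtain a where a: "\<And>q. q \<in> J \<Longrightarrow> poly q a = 0" by blast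
  define y where "y = x(z := a)"
  \<comment> \<open>The algebra generated by \<open>y\<close> over \<open>H\<close>. If one of its
    elements vanishes off \<open>z\<close>, its polynomial is a relation for \<open>x\<close>, so
    the specialization at \<open>z\<close> lies in \<open>J\<close> and has the root
    \<open>a\<close>. This is exactly the axiom \<open>limit_zero\<close>.\<close>
  define H' where "H' = {\<lambda>s. poly (P s) (y s) |P. P \<in> poly_sections}"
  have H'_I: "(\<lambda>s. poly (P s) (y s)) \<in> H'" if "P \<in> poly_sections" for P
    unfolding H'_def using that by (intro CollectI exI[of _ P]) simp
  have "limit_algebra z H'"
  proof
    show "(\<lambda>_. c) \<in> H'" for c
      using H'_I[OF poly_sections_const[of "[:c:]"]] by simp
    fix f g assume "f \<in> H'"
    then obtain P where P: "P \<in> poly_sections" "f = (\<lambda>s. poly (P s) (y s))"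
      unfolding H'_def by blast
    { assume "g \<in> H'"
      then obtain Q where Q: "Q \<in> poly_sections" "g = (\<lambda>s. poly (Q s) (y s))"
        unfolding H'_def by blast
      show "(\<lambda>s. f s + g s) \<in> H'"
        using H'_I[OF poly_sections_add[OF P(1) Q(1)]] P(2) Q(2) by simp
      show "(\<lambda>s. f s * g s) \<in> H'"
        using H'_I[OF poly_sections_mult[OF P(1) Q(1)]] P(2) Q(2) by simp }
    { assume "\<And>s. s \<noteq> z \<Longrightarrow> f s = 0"
      then have "P z \<in> J" using P by (intro J_I) (auto simp: y_def)
      then show "f z = 0" using a P by (simp add: y_def) }
  qed
  moreover have "H \<subseteq> H'"
    using H'_I[OF poly_sections_coeff] by force
  moreover have "y \<in> H'"
    using H'_I[OF poly_sections_const[of "[:0, 1:]"]] by simp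
  ultimately have "y \<in> H" using maximal by blast
  then show ?thesis using extends unfolding y_def by blast
qed

text \<open>The sets whose indicator has limit 1 form an ultrafilter.\<close>
lemma indicator_limit:
  obtains a where "(\<lambda>s. if s \<in> T then 1 else 0)(z := a) \<in> H"
proof (rule extension_cases[of "\<lambda>s. if s \<in> T then 1 else 0"])
  fix P assume P: "P \<in> poly_sections" "P z = 1"
    "\<And>s. s \<noteq> z \<Longrightarrow> poly (P s) (if s \<in> T then 1 else 0) = 0"
  \<comment> \<open>Off \<open>z\<close> one of the two factors vanishes, as the indicator is 0 or
    1. At \<open>z\<close> both factors are 1, because \<open>P z\<close> is the constant polynomial
    1.\<close>
  have "(\<lambda>s. poly (P s) 0 * poly (P s) 1) \<in> H"
    using P(1) by (intro mult poly_sections_eval[where f = "\<lambda>_. c" for c] const)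
  moreover have "poly (P s) 0 * poly (P s) 1 = 0" if "s \<noteq> z" for s
    using P(3)[OF that] by (cases "s \<in> T") auto
  ultimately have "poly (P z) 0 * poly (P z) 1 = 0"
    using limit_zero by blast
  then show ?thesis using P(2) by simp
qed

text \<open>As in the proof that maximal local homomorphisms live on valuation rings: relations of minimal
  degree for \<^term>\<open>x\<close> and for its inverse can be combined into one of smaller degree. Where \<^term>\<open>x\<close>
  vanishes, so does its inverse, and the constant term is corrected by the indicator \<^term>\<open>e\<close> of the
  support.\<close>
lemma no_mutual_obstruction:
  assumes "P \<in> poly_sections" "P z = 1" "\<And>s. s \<noteq> z \<Longrightarrow> poly (P s) (x s) = 0" "\<And>s. degree (P s) \<le> m"
    and "Q \<in> poly_sections" "Q z = 1" "\<And>s. s \<noteq> z \<Longrightarrow> poly (Q s) (inverse (x s)) = 0"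
        "\<And>s. degree (Q s) \<le> n"
  shows False
  using assms
proof (induction "m + n" arbitrary: P Q m n x rule: less_induct)
  case less
  \<comment> \<open>The case \<open>n \<le> m\<close>, in which \<open>P\<close> is replaced by a
    section of smaller degree and \<open>Q\<close> is kept. The other case exchanges
    \<open>x\<close> with its inverse; this is symmetric also where \<open>x\<close> vanishes, since
    \<open>inverse 0 = 0\<close>.\<close>
  have main: False
    if P: "P \<in> poly_sections" "P z = 1" "\<And>s. s \<noteq> z \<Longrightarrow> poly (P s) (x s) = 0" "\<And>s. degree (P s) \<le> m"
    and Q: "Q \<in> poly_sections" "Q z = 1" "\<And>s. s \<noteq> z \<Longrightarrow> poly (Q s) (inverse (x s)) = 0"
        "\<And>s. degree (Q s) \<le> n"
    and IH: "\<And>P' m'. m' < m \<Longrightarrow> P' \<in> poly_sections \<Longrightarrow> P' z = 1 \<Longrightarrow>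
        (\<And>s. s \<noteq> z \<Longrightarrow> poly (P' s) (x s) = 0) \<Longrightarrow> (\<And>s. degree (P' s) \<le> m') \<Longrightarrow> False"
    and nm: "n \<le> m" for P Q m n x
  proof -
    have cP: "(\<lambda>s. coeff (P s) i) \<in> H" and cQ: "(\<lambda>s. coeff (Q s) i) \<in> H" for i
      using P Q unfolding poly_sections_def by auto
    have n0: "n \<noteq> 0"
    proof
      assume "n = 0"
      have "coeff (Q s) 0 = 0" if s: "s \<noteq> z" for s
      proof -
        have "Q s = [:coeff (Q s) 0:]"
          using Q(4)[of s] \<open>n = 0\<close> by (metis degree_eq_zeroE coeff_pCons_0 le_zero_eq)
        then show ?thesis using Q(3)[OF s] by (metis poly_pCons mult_zero_right poly_0 add_0_right)
      qed
      then have "coeff (Q z) 0 = 0" using limit_zero[OF cQ] by blast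
      then show False using Q(2) by simp
    qed
    obtain a where e: "(\<lambda>s. if s \<in> {s. x s \<noteq> 0} then 1 else 0)(z := a) \<in> H"
      using indicator_limit by blast
    define e where "e = (\<lambda>s. if s \<in> {s. x s \<noteq> 0} then 1 else 0 :: 'b)(z := a)"
    have eH: "e \<in> H" using e unfolding e_def .
    \<comment> \<open>The reversed polynomial X^m Q(1/X). Its constant term is the summand
      \<open>j = m\<close>; the factor \<open>e\<close> makes \<open>R\<close> vanish also at points
      with \<open>x s = 0\<close>, where the other summands vanish by themselves.\<close>
    define R where "R = (\<lambda>s. \<Sum>j\<le>n. monom (coeff (Q s) j * (if j = m then e s else 1)) (m - j))"
    \<comment> \<open>The coefficient of X^m in \<open>R\<close> is the constant coefficient of
      \<open>Q\<close>, so this combination cancels the leading terms. At \<open>z\<close> the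
      multipliers are 1 and 0, because \<open>Q z = 1\<close>, \<open>P z = 1\<close> and
      \<open>m > 0\<close>, so the value there is still 1.\<close>
    define P' where "P' = (\<lambda>s. [:coeff (Q s) 0:] * P s + [:- coeff (P s) m:] * R s)"
    have "(\<lambda>s. coeff (Q s) j * (if j = m then e s else 1)) \<in> H" for j
      using mult[OF cQ eH] cQ by (cases "j = m") auto
    then have R: "R \<in> poly_sections"
      unfolding R_def by (intro poly_sections_sum poly_sections_monom) auto
    have "P' \<in> poly_sections"
      unfolding P'_def using P(1) R
      by (intro poly_sections_add poly_sections_mult poly_sections_coeff cQ cP uminus) auto
    moreover have "P' z = 1"
      unfolding P'_def using P(2) Q(2) n0 nm by (simp add: one_pCons[symmetric])
    moreover have "poly (P' s) (x s) = 0" if s: "s \<noteq> z" for s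
    proof -
      have "poly (R s) (x s) = 0"
      proof (cases "x s = 0")
        case True
        then have "e s = 0" using s by (simp add: e_def)
        then show ?thesis
          unfolding R_def poly_sum poly_monom using True nm
          by (intro sum.neutral) auto
      next
        case False
        then have es: "e s = 1" using s by (simp add: e_def)
        have "poly (R s) (x s) = (\<Sum>j\<le>n. x s ^ m * (coeff (Q s) j * inverse (x s) ^ j))"
          unfolding R_def poly_sum poly_monom
        proof (rule sum.cong[OF refl])
          fix j assume "j \<in> {..n}"
          then have "x s ^ m = x s ^ (m - j) * x s ^ j"
            using nm by (simp flip: power_add)
          then show "coeff (Q s) j * (if j = m then e s else 1) * x s ^ (m - j)
              = x s ^ m * (coeff (Q s) j * inverse (x s) ^ j)"
            using False es by (simp add: field_simps)
        qed
        also have "\<dots> = x s ^ m * poly (Q s) (inverse (x s))"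
          using Q(4)[of s] unfolding poly_altdef sum_distrib_left
          by (intro sum.mono_neutral_right) (auto simp: coeff_eq_0)
        finally show ?thesis using Q(3)[OF s] by simp
      qed
      then show ?thesis unfolding P'_def using P(3)[OF s] by simp
    qed
    moreover have "degree (P' s) \<le> m - 1" for s
    proof -
      have "degree (R s) \<le> m"
        unfolding R_def by (rule degree_sum_le) (auto intro: order_trans[OF degree_monom_le])
      then have dm: "degree (P' s) \<le> m"
        unfolding P'_def using P(4)[of s]
        by (intro degree_add_le) (auto intro: order_trans[OF degree_smult_le])
      have "coeff (R s) m = (\<Sum>j\<le>n. if j = 0 then coeff (Q s) 0 else 0)"
        unfolding R_def coeff_sum using n0 nm
        by (intro sum.cong) auto
      then have "coeff (R s) m = coeff (Q s) 0" by simp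
      then have "coeff (P' s) m = 0"
        unfolding P'_def by simp
      then have "degree (P' s) \<noteq> m"
        using n0 nm by (metis degree_0 leading_coeff_0_iff le_zero_eq)
      then show ?thesis using dm by linarith
    qed
    ultimately show False
      by (intro IH[of "m - 1" P']) (use n0 nm in auto)
  qed
  show False
  proof (cases "n \<le> m")
    case True
    show False
    proof (rule main[OF less.prems _ True])
      fix P' m' assume "m' < m" "P' \<in> poly_sections" "P' z = 1"
        "\<And>s. s \<noteq> z \<Longrightarrow> poly (P' s) (x s) = 0" "\<And>s. degree (P' s) \<le> m'"
      then show False
        using less.hyps[of m' n P' x Q] less.prems(5-8) by simp
    qed
  next
    case False
    show False
    proof (rule main[of Q "\<lambda>s. inverse (x s)" n P m])
      fix Q' n' assume "n' < n" "Q' \<in> poly_sections" "Q' z = 1"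
        "\<And>s. s \<noteq> z \<Longrightarrow> poly (Q' s) (inverse (x s)) = 0" "\<And>s. degree (Q' s) \<le> n'"
      then show False
        using less.hyps[of m n' P x Q'] less.prems(1-4) by simp
    qed (use less.prems False in auto)
  qed
qed

text \<open>If \<open>x\<close> is obstructed, its inverse is not, so the inverse has a limit and
  serves as \<open>y\<close>. Since \<open>x\<close> may have zeros, the product
  \<open>x * y\<close> is only the indicator \<open>e\<close> of the support of \<open>x\<close>,
  and it remains to see that \<open>e\<close> has limit 1.\<close>

lemma valuation_property:
  obtains (limit) a where "x(z := a) \<in> H"
  | (pole) y where "y \<in> H" "(\<lambda>s. x s * y s)(z := 1) \<in> H"
proof (rule extension_cases[of x])
  fix P assume P: "P \<in> poly_sections" "P z = 1" "\<And>s. s \<noteq> z \<Longrightarrow> poly (P s) (x s) = 0"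
  show ?thesis
  proof (rule extension_cases[of "\<lambda>s. inverse (x s)"])
    fix Q assume Q: "Q \<in> poly_sections" "Q z = 1" "\<And>s. s \<noteq> z \<Longrightarrow> poly (Q s) (inverse (x s)) = 0"
    obtain m n where "\<And>s. degree (P s) \<le> m" "\<And>s. degree (Q s) \<le> n"
      using P Q unfolding poly_sections_def by blast
    then show ?thesis using no_mutual_obstruction P Q by blast
  next
    fix b assume y: "(\<lambda>s. inverse (x s))(z := b) \<in> H"
    obtain a where e: "(\<lambda>s. if s \<in> {s. x s \<noteq> 0} then 1 else 0)(z := a) \<in> H"
      using indicator_limit by blast
    define e where "e = (\<lambda>s. if s \<in> {s. x s \<noteq> 0} then 1 else 0 :: 'b)(z := a)"
    have eH: "e \<in> H" using e unfolding e_def .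
    \<comment> \<open>Where \<open>x\<close> vanishes, the relation \<open>P\<close> says that its
      constant coefficient is 0; elsewhere \<open>1 - e\<close> is 0. At \<open>z\<close> the
      constant coefficient is 1, which forces \<open>e z = 1\<close>.\<close>
    have "(\<lambda>s. coeff (P s) 0 * (1 - e s)) \<in> H"
      using P(1) eH unfolding poly_sections_def by (auto intro!: mult diff const)
    moreover have "coeff (P s) 0 * (1 - e s) = 0" if s: "s \<noteq> z" for s
      using P(3)[OF s] s by (auto simp: e_def poly_0_coeff_0)
    ultimately have "coeff (P z) 0 * (1 - e z) = 0" using limit_zero by blast
    then have "e z = 1" using P(2) by simp
    then have "(\<lambda>s. x s * ((\<lambda>s. inverse (x s))(z := b)) s)(z := 1) = e"
      by (auto simp: e_def fun_eq_iff)
    then show ?thesis using pole[OF y] eH by simp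
  qed
qed (use limit in blast)

text \<open>The valuative criterion for projective space: homogeneous coordinates \<open>c\<close>,
  arbitrary nonzero vectors at the points other than \<open>z\<close>, are rescaled by
  \<open>l\<close> so that all of them have limits and one limit is 1. The factor \<open>l\<close>
  may vanish at some points, as long as the limit does not see them.\<close>

lemma normalization:
  assumes "finite I" and nz: "\<And>s. s \<noteq> z \<Longrightarrow> \<exists>i\<in>I. c i s \<noteq> 0"
  obtains l b i0 where "\<And>i. i \<in> I \<Longrightarrow> b i \<in> H" "\<And>i s. i \<in> I \<Longrightarrow> s \<noteq> z \<Longrightarrow> b i s = l s * c i s"
    "i0 \<in> I" "b i0 z = 1"
proof -
  define p where "p s = (SOME i. i \<in> I \<and> c i s \<noteq> 0)" for s
  have p: "p s \<in> I" "c (p s) s \<noteq> 0" if "s \<noteq> z" for s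
    using someI_ex[of "\<lambda>i. i \<in> I \<and> c i s \<noteq> 0"] nz[OF that] unfolding p_def by blast+
  have "\<exists>a. (\<lambda>s. if s \<in> {s. p s = i} then 1 else 0)(z := a) \<in> H" for i
    by (rule indicator_limit[of "{s. p s = i}"]) (rule exI)
  then obtain v where v: "\<And>i. (\<lambda>s. if s \<in> {s. p s = i} then 1 else 0)(z := v i) \<in> H"
    by metis
  define e where "e i = (\<lambda>s. if s \<in> {s. p s = i} then 1 else 0 :: 'b)(z := v i)" for i
  have eH: "e i \<in> H" for i using v unfolding e_def .
  \<comment> \<open>The finitely many sets where \<open>p s = i\<close> partition the points other
    than \<open>z\<close>. Hence some indicator has a nonzero limit, and an idempotent nonzero limit
    is 1.\<close>
  have "(\<Sum>i\<in>I. e i z) = 1"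
  proof (rule limit_eq[of "\<lambda>s. \<Sum>i\<in>I. e i s" "\<lambda>_. 1"])
    show "(\<Sum>i\<in>I. e i s) = 1" if s: "s \<noteq> z" for s
    proof -
      have "(\<Sum>i\<in>I. e i s) = (\<Sum>i\<in>I. if p s = i then 1 else 0)"
        using s by (intro sum.cong) (auto simp: e_def)
      then show ?thesis using p(1)[OF s] assms(1) by simp
    qed
  qed (use assms eH in \<open>auto intro: sum const\<close>)
  then obtain j where j: "j \<in> I" "e j z \<noteq> 0"
    by (metis sum.neutral zero_neq_one)
  have "e j z * e j z = e j z"
    by (rule limit_eq[OF mult[OF eH eH] eH]) (simp add: e_def)
  then have ej: "e j z = 1" using j by simp
  have "\<exists>l b i0. (\<forall>i\<in>insert j A. b i \<in> H \<and> (\<forall>s. s \<noteq> z \<longrightarrow> b i s = l s * c i s)) \<and> i0 \<in> insert j A \<and> b i0 z = 1"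
    if "finite A" for A
    using that
  proof (induction A rule: finite_induct)
    case empty
    \<comment> \<open>Start with coordinate \<open>j\<close> alone, scaled to 1 on the set where
      \<open>p s = j\<close> and to 0 off it.\<close>
    have "e j s = (e j s / c j s) * c j s" if s: "s \<noteq> z" for s
      using p(2)[OF s] s by (auto simp: e_def)
    then show ?case using eH ej
      by (intro exI[of _ "\<lambda>s. e j s / c j s"] exI[of _ e] exI[of _ j]) auto
  next
    case (insert k A)
    then obtain l b i0 where IH: "\<And>i. i \<in> insert j A \<Longrightarrow> b i \<in> H"
      "\<And>i s. i \<in> insert j A \<Longrightarrow> s \<noteq> z \<Longrightarrow> b i s = l s * c i s" "i0 \<in> insert j A" "b i0 z = 1"
      by blast
    show ?case
    proof (cases "k = j")
      case True
      then show ?thesis using IH by (intro exI[of _ l] exI[of _ b] exI[of _ i0]) auto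
    next
      case False
      show ?thesis
      proof (rule valuation_property[of "\<lambda>s. l s * c k s"])
        fix a assume "(\<lambda>s. l s * c k s)(z := a) \<in> H"
        then show ?thesis
          using IH insert.hyps False
          by (intro exI[of _ l] exI[of _ "b(k := (\<lambda>s. l s * c k s)(z := a))"] exI[of _ i0]) auto
      next
        \<comment> \<open>The new coordinate has a pole. Multiplying everything by \<open>y\<close>
          gives it limit 1, and the earlier coordinates stay in \<open>H\<close>.\<close>
        fix y assume y: "y \<in> H" "(\<lambda>s. l s * c k s * y s)(z := 1) \<in> H"
        then show ?thesis
          using IH insert.hyps False
          by (intro exI[of _ "\<lambda>s. l s * y s"]
              exI[of _ "(\<lambda>i s. b i s * y s)(k := (\<lambda>s. l s * c k s * y s)(z := 1))"] exI[of _ k])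
            (auto intro: mult)
      qed
    qed
  qed
  from this[OF assms(1)] obtain l b i0 where
    "\<forall>i\<in>I. b i \<in> H \<and> (\<forall>s. s \<noteq> z \<longrightarrow> b i s = l s * c i s)" "i0 \<in> I" "b i0 z = 1"
    unfolding insert_absorb[OF j(1)] by blast
  then show ?thesis by (intro that[of b l i0]) auto
qed

end

text \<open>Zorn applies because every axiom concerns at most two functions, which lie in a common
  member of a chain.\<close>

lemma maximal_limit_algebra_exists:
  assumes "alg_closed TYPE('f::field)" "limit_algebra z (H0 :: ('t \<Rightarrow> 'f) set)"
  obtains H where "H0 \<subseteq> H" "maximal_limit_algebra z H"
proof -
  let ?A = "{H. H0 \<subseteq> H \<and> limit_algebra z H}"
  have "\<exists>M\<in>?A. \<forall>X\<in>?A. M \<subseteq> X \<longrightarrow> X = M"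
  proof (rule subset_Zorn_nonempty)
    show "?A \<noteq> {}" using assms by blast
    fix C assume C: "C \<noteq> {}" "subset.chain ?A C"
    then have alg: "\<And>X. X \<in> C \<Longrightarrow> limit_algebra z X \<and> H0 \<subseteq> X"
      by (auto simp: subset_chain_def)
    have common: "\<exists>X\<in>C. f \<in> X \<and> g \<in> X" if "f \<in> \<Union>C" "g \<in> \<Union>C" for f g
    proof -
      from that obtain X Y where XY: "X \<in> C" "f \<in> X" "Y \<in> C" "g \<in> Y" by blast
      then have "X \<subseteq> Y \<or> Y \<subseteq> X" using C(2) unfolding subset_chain_def by blast
      then show ?thesis using XY by blast
    qed
    have "limit_algebra z (\<Union>C)"
    proof
      show "(\<lambda>_. c) \<in> \<Union>C" for c
      proof -
        obtain X where X: "X \<in> C" using C(1) by blast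
        then interpret limit_algebra z X using alg by blast
        show ?thesis using X const by blast
      qed
      fix f g assume f: "f \<in> \<Union>C"
      { assume g: "g \<in> \<Union>C"
        obtain X where X: "X \<in> C" "f \<in> X" "g \<in> X" using common[OF f g] by blast
        then interpret limit_algebra z X using alg by blast
        show "(\<lambda>s. f s + g s) \<in> \<Union>C" "(\<lambda>s. f s * g s) \<in> \<Union>C"
          using X add[of f g] mult[of f g] by blast+ }
      assume "\<And>s. s \<noteq> z \<Longrightarrow> f s = 0"
      moreover obtain X where X: "X \<in> C" "f \<in> X" using f by blast
      ultimately show "f z = 0" using alg limit_algebra.limit_zero[of z X f] by blast
    qed
    then show "\<Union>C \<in> ?A" using C alg by blast
  qed
  then obtain H where H: "H \<in> ?A" and max: "\<forall>X\<in>?A. H \<subseteq> X \<longrightarrow> X = H"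
    by (elim bexE)
  then interpret limit_algebra z H by simp
  have "maximal_limit_algebra z H"
  proof
    show "alg_closed TYPE('f)" by fact
    fix X assume "limit_algebra z X" "H \<subseteq> X"
    moreover from this H have "X \<in> ?A" by auto
    ultimately show "X = H" using max by simp
  qed
  then show ?thesis using that[of H] H by auto
qed

section \<open>Limits of families of subspaces\<close>

lemma fscale_vector_space: "vector_space (fscale :: 'f::field \<Rightarrow> ('a \<Rightarrow> 'f) \<Rightarrow> _)"
  by unfold_locales (auto simp: fscale_def fun_eq_iff algebra_simps)

lemma fscale2_vector_space: "vector_space (fscale2 :: 'f::field \<Rightarrow> ('a \<Rightarrow> 'c \<Rightarrow> 'f) \<Rightarrow> _)"
  by unfold_locales (auto simp: fscale2_def fscale_def fun_eq_iff algebra_simps)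

interpretation fs: vector_space "fscale :: 'f::field \<Rightarrow> ('a \<Rightarrow> 'f) \<Rightarrow> _"
  by (rule fscale_vector_space)

interpretation fs2: vector_space "fscale2 :: 'f::field \<Rightarrow> ('a \<Rightarrow> 'c \<Rightarrow> 'f) \<Rightarrow> _"
  by (rule fscale2_vector_space)

lemma fscale2_apply: "fscale2 k F a c = k * F a c"
  by (simp add: fscale2_def fscale_def)

lemma sum_apply2: "(\<Sum>i\<in>A. F i) a c = (\<Sum>i\<in>A. F i a c)"
  by (induction A rule: infinite_finite_induct) auto

definition supported :: "('a \<times> 'c) set \<Rightarrow> ('a \<Rightarrow> 'c \<Rightarrow> 'f::field) set" where
  "supported J = {F. \<forall>a c. (a, c) \<notin> J \<longrightarrow> F a c = 0}"

lemma supported_finite_span: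
  assumes "finite J"
  obtains T :: "('a \<Rightarrow> 'c \<Rightarrow> 'f::field) set"
  where "finite T" "supported J \<subseteq> fs2.span T" "card T \<le> card J"
proof -
  define unit :: "'a \<times> 'c \<Rightarrow> 'a \<Rightarrow> 'c \<Rightarrow> 'f" where
    "unit j = (\<lambda>a c. if (a, c) = j then 1 else 0)" for j
  have "F \<in> fs2.span (unit ` J)" if F: "F \<in> supported J" for F
  proof -
    have expand: "F a c = (\<Sum>j\<in>J. F (fst j) (snd j) * unit j a c)" for a c
    proof -
      have "(\<Sum>j\<in>J. F (fst j) (snd j) * unit j a c) = (\<Sum>j\<in>J. if j = (a, c) then F a c else 0)"
        by (intro sum.cong) (auto simp: unit_def)
      also have "\<dots> = F a c"
        using F assms by (auto simp: supported_def)
      finally show ?thesis by simp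
    qed
    have "F = (\<Sum>j\<in>J. fscale2 (F (fst j) (snd j)) (unit j))"
      unfolding fun_eq_iff sum_apply2 fscale2_apply by (intro allI expand)
    also have "\<dots> \<in> fs2.span (unit ` J)"
      by (intro fs2.span_sum fs2.span_scale fs2.span_base) auto
    finally show ?thesis .
  qed
  then show ?thesis
    using that[of "unit ` J"] assms card_image_le by blast
qed

section \<open>Limits of arbitrary families of subspaces keep the dimension\<close>

context maximal_limit_algebra
begin

text \<open>Limits of those vector families that lie in \<open>U s\<close> off \<open>z\<close> and
  have all coordinates in \<open>H\<close>. The family \<open>U\<close> is subject to no regularity
  in \<open>s\<close>, and \<open>U z\<close> does not enter.\<close>

definition limit_space :: "('a \<Rightarrow> ('c \<Rightarrow> 'd \<Rightarrow> 'b) set) \<Rightarrow> ('c \<Rightarrow> 'd \<Rightarrow> 'b) set" where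
  "limit_space U = {u z |u. (\<forall>a c. (\<lambda>s. u s a c) \<in> H) \<and> (\<forall>s. s \<noteq> z \<longrightarrow> u s \<in> U s)}"

lemma limit_spaceI:
  "(\<And>a c. (\<lambda>s. u s a c) \<in> H) \<Longrightarrow> (\<And>s. s \<noteq> z \<Longrightarrow> u s \<in> U s) \<Longrightarrow> u z \<in> limit_space U"
  unfolding limit_space_def by auto

lemma limit_spaceE:
  assumes "x \<in> limit_space U"
  obtains u where "x = u z" "\<And>a c. (\<lambda>s. u s a c) \<in> H" "\<And>s. s \<noteq> z \<Longrightarrow> u s \<in> U s"
proof -
  from assms have "\<exists>u. x = u z \<and> (\<forall>a c. (\<lambda>s. u s a c) \<in> H) \<and> (\<forall>s. s \<noteq> z \<longrightarrow> u s \<in> U s)"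
    unfolding limit_space_def by (rule CollectD)
  then show ?thesis using that by (elim exE conjE) simp
qed

lemma limit_space_mono:
  assumes "\<And>s. s \<noteq> z \<Longrightarrow> U s \<subseteq> V s"
  shows "limit_space U \<subseteq> limit_space V"
proof
  fix x assume "x \<in> limit_space U"
  then obtain u where "x = u z" "\<And>a c. (\<lambda>s. u s a c) \<in> H" "\<And>s. s \<noteq> z \<Longrightarrow> u s \<in> U s"
    by (rule limit_spaceE) simp
  then show "x \<in> limit_space V" using assms limit_spaceI[of u V] by blast
qed

lemma subspace_limit_space:
  assumes "\<And>s. s \<noteq> z \<Longrightarrow> fs2.subspace (U s)"
  shows "fs2.subspace (limit_space U)"
proof (rule fs2.subspaceI)
  show "0 \<in> limit_space U"
    by (rule limit_spaceI[where u = "\<lambda>_. 0"]) (use const fs2.subspace_0[OF assms] in simp_all)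
  fix x assume "x \<in> limit_space U"
  then obtain u where u: "x = u z" "\<And>a c. (\<lambda>s. u s a c) \<in> H" "\<And>s. s \<noteq> z \<Longrightarrow> u s \<in> U s"
    by (rule limit_spaceE) simp
  { fix y assume "y \<in> limit_space U"
    then obtain v where v: "y = v z" "\<And>a c. (\<lambda>s. v s a c) \<in> H" "\<And>s. s \<noteq> z \<Longrightarrow> v s \<in> U s"
      by (rule limit_spaceE) simp
    have "u z + v z \<in> limit_space U"
      by (rule limit_spaceI[where u = "\<lambda>s. u s + v s"])
        (use add[OF u(2) v(2)] fs2.subspace_add[OF assms u(3) v(3)] in simp_all)
    then show "x + y \<in> limit_space U" using u v by simp }
  fix k
  have "fscale2 k (u z) \<in> limit_space U"
  proof (rule limit_spaceI[where u = "\<lambda>s. fscale2 k (u s)"])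
    show "(\<lambda>s. fscale2 k (u s) a c) \<in> H" for a c
      unfolding fscale2_apply by (intro mult const u(2))
    show "fscale2 k (u s) \<in> U s" if "s \<noteq> z" for s
      using fs2.subspace_scale[OF assms u(3)] that by blast
  qed
  then show "fscale2 k x \<in> limit_space U" using u by simp
qed

lemma limit_space_supported:
  assumes "\<And>s. s \<noteq> z \<Longrightarrow> U s \<subseteq> supported J"
  shows "limit_space U \<subseteq> supported J"
proof
  fix x assume "x \<in> limit_space U"
  then obtain u where u: "x = u z" "\<And>a c. (\<lambda>s. u s a c) \<in> H" "\<And>s. s \<noteq> z \<Longrightarrow> u s \<in> U s"
    by (rule limit_spaceE) simp
  have "u z a c = 0" if "(a, c) \<notin> J" for a c
  proof (rule limit_zero[OF u(2)])
    fix s assume "s \<noteq> z"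
    then have "u s \<in> supported J" using u(3) assms by blast
    then show "u s a c = 0" using that by (simp add: supported_def)
  qed
  then show "x \<in> supported J" using u by (simp add: supported_def)
qed

text \<open>Lift a basis of the limit to families in \<open>U s\<close>. If it had more than
  \<open>d\<close> elements, the lifts would be dependent at every point; the coefficients,
  normalized to have limits not all zero, would give in the limit a relation on the basis.\<close>

lemma dim_limit_space_le:
  assumes "finite J" and supp: "\<And>s. s \<noteq> z \<Longrightarrow> U s \<subseteq> supported J"
    and d: "\<And>s. s \<noteq> z \<Longrightarrow> fs2.dim (U s) \<le> d"
  shows "fs2.dim (limit_space U) \<le> d"
proof (rule ccontr)
  assume "\<not> fs2.dim (limit_space U) \<le> d"
  then have big: "d < fs2.dim (limit_space U)" by simp
  obtain B where B: "B \<subseteq> limit_space U" "fs2.independent B" "limit_space U \<subseteq> fs2.span B"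
    "card B = fs2.dim (limit_space U)"
    by (rule fs2.basis_exists)
  have finB: "finite B"
    using B(4) big by (metis card.infinite not_less_zero)
  obtain T :: "('c \<Rightarrow> 'd \<Rightarrow> 'b) set" where T: "finite T" "supported J \<subseteq> fs2.span T"
    by (rule supported_finite_span[OF assms(1)])
  have "\<forall>x\<in>B. \<exists>u. x = u z \<and> (\<forall>a c. (\<lambda>s. u s a c) \<in> H) \<and> (\<forall>s. s \<noteq> z \<longrightarrow> u s \<in> U s)"
    using B(1) unfolding limit_space_def by (intro ballI) (drule (1) subsetD, erule CollectD)
  from bchoice[OF this] obtain u where "\<forall>x\<in>B. x = u x z \<and> (\<forall>a c. (\<lambda>s. u x s a c) \<in> H) \<and>
      (\<forall>s. s \<noteq> z \<longrightarrow> u x s \<in> U s)"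
    by (rule exE)
  then have u: "\<And>x. x \<in> B \<Longrightarrow> x = u x z" "\<And>x a c. x \<in> B \<Longrightarrow> (\<lambda>s. u x s a c) \<in> H"
    "\<And>x s. x \<in> B \<Longrightarrow> s \<noteq> z \<Longrightarrow> u x s \<in> U s"
    by blast+
  have dep: "\<exists>k. (\<exists>x\<in>B. k x \<noteq> 0) \<and> (\<Sum>x\<in>B. fscale2 (k x) (u x s)) = 0" if s: "s \<noteq> z" for s
  proof (rule fs2.family_dependent[OF T(1)])
    show "U s \<subseteq> fs2.span T" using T(2) supp[OF s] by (rule order_trans[rotated])
    show "finite B" by (rule finB)
    show "u x s \<in> U s" if "x \<in> B" for x using u(3)[OF that s] .
    show "fs2.dim (U s) < card B" using d[OF s] big B(4) by simp
  qed
  have "\<forall>s. \<exists>k. s \<noteq> z \<longrightarrow> (\<exists>x\<in>B. k x \<noteq> 0) \<and> (\<Sum>x\<in>B. fscale2 (k x) (u x s)) = 0"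
    using dep by blast
  from choice[OF this] obtain k where k: "\<And>s. s \<noteq> z \<Longrightarrow> \<exists>x\<in>B. k s x \<noteq> 0"
    "\<And>s. s \<noteq> z \<Longrightarrow> (\<Sum>x\<in>B. fscale2 (k s x) (u x s)) = 0"
    by auto
  obtain l b x0 where b: "\<And>x. x \<in> B \<Longrightarrow> b x \<in> H"
    "\<And>x s. x \<in> B \<Longrightarrow> s \<noteq> z \<Longrightarrow> b x s = l s * k s x" "x0 \<in> B" "b x0 z = 1"
    by (rule normalization[OF finB, where c = "\<lambda>x s. k s x", OF k(1)]) (assumption, rule that)
  have "(\<Sum>x\<in>B. b x z * u x z a c) = 0" for a c
  proof (rule limit_zero[of "\<lambda>s. \<Sum>x\<in>B. b x s * u x s a c"])
    show "(\<lambda>s. \<Sum>x\<in>B. b x s * u x s a c) \<in> H"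
      using finB b u by (intro sum mult) auto
    fix s assume s: "s \<noteq> z"
    have "(\<Sum>x\<in>B. b x s * u x s a c) = l s * (\<Sum>x\<in>B. fscale2 (k s x) (u x s)) a c"
      unfolding sum_apply2 sum_distrib_left fscale2_apply
      by (intro sum.cong) (auto simp: b(2)[OF _ s] mult.assoc)
    then show "(\<Sum>x\<in>B. b x s * u x s a c) = 0" by (simp add: k(2)[OF s])
  qed
  then have "(\<Sum>x\<in>B. fscale2 (b x z) x) = 0"
    by (simp add: fun_eq_iff sum_apply2 fscale2_apply u(1)[symmetric] cong: sum.cong_simp)
  then have "b x0 z = 0"
    by (rule fs2.independentD[OF B(2) finB order_refl _ b(3)])
  then show False using b(4) by simp
qed

text \<open>Induction on \<open>d\<close>: a nonzero vector of each \<open>U s\<close>, rescaled by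
  \<open>normalization\<close>, has a limit with some coordinate equal to 1. The hyperplane where
  this coordinate vanishes costs each \<open>U s\<close> at most one dimension, and the limits taken
  inside it cannot span the vector just found.\<close>

lemma independent_limit_space:
  assumes "finite J" "\<And>s. s \<noteq> z \<Longrightarrow> U s \<subseteq> supported J" "\<And>s. s \<noteq> z \<Longrightarrow> fs2.subspace (U s)"
    and "\<And>s. s \<noteq> z \<Longrightarrow> d \<le> fs2.dim (U s)"
  shows "\<exists>B\<subseteq>limit_space U. finite B \<and> fs2.independent B \<and> card B = d"
  using assms
proof (induction d arbitrary: U)
  case 0
  show ?case
    by (intro exI[of _ "{}"] conjI fs2.independent_empty) simp_all
next
  case (Suc d)
  obtain T :: "('c \<Rightarrow> 'd \<Rightarrow> 'b) set" where T: "finite T" "supported J \<subseteq> fs2.span T"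
    by (rule supported_finite_span[OF assms(1)])
  have "\<exists>w\<in>U s. w \<noteq> 0" if s: "s \<noteq> z" for s
  proof (rule ccontr)
    assume "\<not> (\<exists>w\<in>U s. w \<noteq> 0)"
    then have "U s \<subseteq> fs2.span {}" by auto
    then have "fs2.dim (U s) \<le> 0" using fs2.dim_le_card[of "U s" "{}"] by simp
    then show False using Suc.prems(4)[OF s] by simp
  qed
  then obtain w where w: "\<And>s. s \<noteq> z \<Longrightarrow> w s \<in> U s" "\<And>s. s \<noteq> z \<Longrightarrow> w s \<noteq> 0"
    by metis
  have w_supp: "w s a c = 0" if "s \<noteq> z" "(a, c) \<notin> J" for s a c
    using w(1) Suc.prems(2) that by (force simp: supported_def)
  have nz: "\<exists>j\<in>J. w s (fst j) (snd j) \<noteq> 0" if s: "s \<noteq> z" for s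
  proof -
    obtain a c where "w s a c \<noteq> 0" using w(2)[OF s] by (auto simp: fun_eq_iff)
    then show ?thesis using w_supp[OF s] by (intro bexI[of _ "(a, c)"]) auto
  qed
  obtain l b j0 where b: "\<And>j. j \<in> J \<Longrightarrow> b j \<in> H"
    "\<And>j s. j \<in> J \<Longrightarrow> s \<noteq> z \<Longrightarrow> b j s = l s * w s (fst j) (snd j)" "j0 \<in> J" "b j0 z = 1"
    by (rule normalization[OF Suc.prems(1), where c = "\<lambda>j s. w s (fst j) (snd j)", OF nz]) (assumption, rule that)
  obtain a0 c0 where j0: "j0 = (a0, c0)" by fastforce
  \<comment> \<open>Off \<open>z\<close> this is a multiple of \<open>w s\<close>, hence in
    \<open>U s\<close>; at \<open>z\<close> its coordinate \<open>j0\<close> is 1.\<close>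
  define u where "u = (\<lambda>s a c. if (a, c) \<in> J then b (a, c) s else 0)"
  have "u s \<in> U s" if s: "s \<noteq> z" for s
  proof -
    have "u s = fscale2 (l s) (w s)"
      using b(2) s w_supp by (auto simp: u_def fun_eq_iff fscale2_apply)
    then show ?thesis using fs2.subspace_scale[OF Suc.prems(3) w(1)] s by simp
  qed
  moreover have "(\<lambda>s. u s a c) \<in> H" for a c
    unfolding u_def using b(1) const by (cases "(a, c) \<in> J") auto
  ultimately have uz: "u z \<in> limit_space U" by (intro limit_spaceI)
  define U' where "U' s = {x \<in> U s. x a0 c0 = 0}" for s
  have "\<exists>B\<subseteq>limit_space U'. finite B \<and> fs2.independent B \<and> card B = d"
  proof (rule Suc.IH[OF Suc.prems(1)])
    fix s assume s: "s \<noteq> z"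
    have "U' s \<subseteq> U s" by (auto simp: U'_def)
    then show "U' s \<subseteq> supported J" using Suc.prems(2)[OF s] by (rule order_trans)
    show "fs2.subspace (U' s)"
      using Suc.prems(3)[OF s] unfolding U'_def fs2.subspace_def by (simp add: fscale2_apply)
    have "fs2.dim (U s) \<le> Suc (fs2.dim (U' s))"
      unfolding U'_def
    proof (rule fs2.dim_kernel_functional[OF T(1) _ Suc.prems(3)[OF s]])
      show "U s \<subseteq> fs2.span T" using T(2) Suc.prems(2)[OF s] by (rule order_trans[rotated])
    qed (simp_all add: fscale2_apply)
    then show "d \<le> fs2.dim (U' s)" using Suc.prems(4)[OF s] by simp
  qed
  then obtain B where B: "B \<subseteq> limit_space U'" "finite B" "fs2.independent B" "card B = d"
    by (elim exE conjE)
  have "fs2.subspace {x. x a0 c0 = 0}" by (simp add: fs2.subspace_def fscale2_apply)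
  moreover have "B \<subseteq> {x. x a0 c0 = 0}"
  proof
    fix x assume "x \<in> B"
    then have "x \<in> limit_space U'" using B(1) by blast
    then obtain v where v: "x = v z" "\<And>a c. (\<lambda>s. v s a c) \<in> H" "\<And>s. s \<noteq> z \<Longrightarrow> v s \<in> U' s"
      by (rule limit_spaceE) simp
    have "v z a0 c0 = 0"
    proof (rule limit_zero[OF v(2)])
      show "v s a0 c0 = 0" if "s \<noteq> z" for s
        using v(3)[OF that] by (simp add: U'_def)
    qed
    then show "x \<in> {x. x a0 c0 = 0}" using v by simp
  qed
  ultimately have "fs2.span B \<subseteq> {x. x a0 c0 = 0}" by (intro fs2.span_minimal)
  moreover have "u z a0 c0 = 1" using b(3,4) j0 by (simp add: u_def)
  ultimately have nsp: "u z \<notin> fs2.span B" by auto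
  then have "u z \<notin> B" using fs2.span_base by blast
  have "limit_space U' \<subseteq> limit_space U"
    by (rule limit_space_mono) (simp add: U'_def)
  then have "insert (u z) B \<subseteq> limit_space U" using uz B(1) by simp
  then show ?case
    using B(2,4) \<open>u z \<notin> B\<close> fs2.independent_insertI[OF nsp B(3)]
    by (intro exI[of _ "insert (u z) B"] conjI) simp_all
qed

lemma dim_limit_space_ge:
  assumes J: "finite J" "\<And>s. s \<noteq> z \<Longrightarrow> U s \<subseteq> supported J" and "\<And>s. s \<noteq> z \<Longrightarrow> fs2.subspace (U s)"
    and "\<And>s. s \<noteq> z \<Longrightarrow> d \<le> fs2.dim (U s)"
  shows "d \<le> fs2.dim (limit_space U)"
proof -
  have "\<exists>B\<subseteq>limit_space U. finite B \<and> fs2.independent B \<and> card B = d"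
    by (rule independent_limit_space[of J]) (fact assms)+
  then obtain B where B: "B \<subseteq> limit_space U" "finite B" "fs2.independent B" "card B = d"
    by (elim exE conjE)
  obtain T :: "('c \<Rightarrow> 'd \<Rightarrow> 'b) set" where T: "finite T" "supported J \<subseteq> fs2.span T"
    by (rule supported_finite_span[OF assms(1)])
  have "limit_space U \<subseteq> supported J"
    by (rule limit_space_supported) (fact J(2))
  then have "limit_space U \<subseteq> fs2.span T"
    using T(2) by (rule order_trans)
  then show ?thesis
    using fs2.independent_card_le_dim_finite(2)[OF T(1) _ B(3,1)] B(4) by simp
qed

end

section \<open>Zariski density\<close>

text \<open>Otherwise one plus the product of all \<open>X - a\<close> would be a non-constant
  polynomial without a root.\<close>

lemma alg_closed_infinite:
  assumes "alg_closed TYPE('f::field)"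
  shows "infinite (UNIV :: 'f set)"
proof
  assume fin: "finite (UNIV :: 'f set)"
  define q :: "'f poly" where "q = (\<Prod>a\<in>UNIV. [:- a, 1:])"
  have "degree q = card (UNIV :: 'f set)"
    unfolding q_def by (subst degree_prod_eq_sum_degree) auto
  then have "degree q > 0" using fin by (simp add: card_gt_0_iff)
  then have "degree (q + 1) > 0" by (subst degree_add_eq_left) auto
  then obtain x where "poly (q + 1) x = 0"
    using assms unfolding alg_closed_def by blast
  moreover have "poly q x = 0"
    unfolding q_def poly_prod using fin by (intro prod_zero) auto
  ultimately show False by simp
qed

lemma poly_funs_line:
  assumes "f \<in> poly_funs I"
  shows "\<exists>q. \<forall>t. f (\<lambda>v. a v + t * b v) = poly q t"
  using assms
proof (induction rule: poly_funs.induct)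
  case (pf_const c)
  show ?case by (intro exI[of _ "[:c:]"]) simp
next
  case (pf_var v)
  show ?case by (intro exI[of _ "[:a v, b v:]"]) (simp add: algebra_simps)
next
  case (pf_add f g)
  then obtain q r where "\<forall>t. f (\<lambda>v. a v + t * b v) = poly q t" "\<forall>t. g (\<lambda>v. a v + t * b v) = poly r t"
    by (elim exE)
  then show ?case by (intro exI[of _ "q + r"]) simp
next
  case (pf_mult f g)
  then obtain q r where "\<forall>t. f (\<lambda>v. a v + t * b v) = poly q t" "\<forall>t. g (\<lambda>v. a v + t * b v) = poly r t"
    by (elim exE)
  then show ?case by (intro exI[of _ "q * r"]) simp
qed

text \<open>Restrict to the line through \<open>p\<close> and \<open>q\<close>: both functions
  become nonzero polynomials in one variable, and their product has only finitely many roots in an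
  infinite field.\<close>

lemma poly_funs_mult_nonzero:
  fixes f g :: "('v \<Rightarrow> 'f::field) \<Rightarrow> 'f"
  assumes "alg_closed TYPE('f)" and f: "f \<in> poly_funs I" "p \<in> affine_points I" "f p \<noteq> 0"
    and g: "g \<in> poly_funs I" "q \<in> affine_points I" "g q \<noteq> 0"
  shows "\<exists>r\<in>affine_points I. f r * g r \<noteq> 0"
proof -
  define b where "b v = q v - p v" for v
  obtain F where F: "\<And>t. f (\<lambda>v. p v + t * b v) = poly F t"
    using poly_funs_line[OF f(1), of p b] by blast
  obtain K where K: "\<And>t. g (\<lambda>v. p v + t * b v) = poly K t"
    using poly_funs_line[OF g(1), of p b] by blast
  have "poly F 0 \<noteq> 0" "poly K 1 \<noteq> 0"
    using F[of 0] K[of 1] f(3) g(3) by (auto simp: b_def)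
  then have "F * K \<noteq> 0" by auto
  then have "finite {t. poly (F * K) t = 0}" by (rule poly_roots_finite)
  then obtain t where "poly (F * K) t \<noteq> 0"
    using alg_closed_infinite[OF assms(1)] by (metis (mono_tags, lifting) UNIV_eq_I mem_Collect_eq)
  then show ?thesis
    using f(2) g(2) F K
    by (intro bexI[of _ "\<lambda>v. p v + t * b v"]) (auto simp: affine_points_def b_def)
qed

lemma zariski_dense_mono:
  "zariski_dense I S \<Longrightarrow> S \<subseteq> T \<Longrightarrow> T \<subseteq> affine_points I \<Longrightarrow> zariski_dense I T"
  unfolding zariski_dense_def by blast

lemma zariski_dense_affine: "zariski_dense I (affine_points I)"
  unfolding zariski_dense_def by blast

lemma zariski_denseD:
  "zariski_dense I S \<Longrightarrow> f \<in> poly_funs I \<Longrightarrow> (\<And>s. s \<in> S \<Longrightarrow> f s = 0) \<Longrightarrow> p \<in> affine_points I \<Longrightarrow> f p = 0"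
  by (simp add: zariski_dense_def)

lemma not_zariski_denseE:
  assumes "\<not> zariski_dense I S" "S \<subseteq> affine_points I"
  obtains f p where "f \<in> poly_funs I" "\<And>s. s \<in> S \<Longrightarrow> f s = 0" "p \<in> affine_points I" "f p \<noteq> 0"
proof -
  from assms have "\<exists>f\<in>poly_funs I. (\<forall>s\<in>S. f s = 0) \<and> (\<exists>p\<in>affine_points I. f p \<noteq> 0)"
    by (simp add: zariski_dense_def)
  then show ?thesis using that by (elim bexE conjE) simp
qed

lemma zariski_dense_nonempty:
  assumes "zariski_dense I (S :: ('v \<Rightarrow> 'f::field) set)"
  shows "S \<noteq> {}"
proof
  assume S: "S = {}"
  have "(\<lambda>_. 0) \<in> (affine_points I :: ('v \<Rightarrow> 'f) set)"
    unfolding affine_points_def by simp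
  from zariski_denseD[OF assms pf_const[of 1] _ this] S show False by simp
qed

text \<open>Irreducibility of affine space: the product of two functions witnessing non-density
  vanishes on the union but not everywhere.\<close>

lemma zariski_dense_Un:
  fixes S T :: "('v \<Rightarrow> 'f::field) set"
  assumes cl: "alg_closed TYPE('f)" and ST: "zariski_dense I (S \<union> T)"
  shows "zariski_dense I S \<or> zariski_dense I T"
proof (rule ccontr)
  assume no: "\<not> ?thesis"
  have sub: "S \<subseteq> affine_points I" "T \<subseteq> affine_points I"
    using ST by (simp_all add: zariski_dense_def)
  obtain f p where f: "f \<in> poly_funs I" "\<And>s. s \<in> S \<Longrightarrow> f s = 0" "p \<in> affine_points I" "f p \<noteq> 0"
    using no sub not_zariski_denseE[of I S] by metis
  obtain g q where g: "g \<in> poly_funs I" "\<And>s. s \<in> T \<Longrightarrow> g s = 0" "q \<in> affine_points I" "g q \<noteq> 0"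
    using no sub not_zariski_denseE[of I T] by metis
  obtain r where "r \<in> affine_points I" "f r * g r \<noteq> 0"
    using poly_funs_mult_nonzero[OF cl f(1,3,4) g(1,3,4)] by (elim bexE)
  moreover have "f s * g s = 0" if "s \<in> S \<union> T" for s
    using that f(2) g(2) by auto
  ultimately show False
    using zariski_denseD[OF ST pf_mult[OF f(1) g(1)], of r] by blast
qed

lemma zariski_dense_UN:
  fixes S :: "'i \<Rightarrow> ('v \<Rightarrow> 'f::field) set"
  assumes cl: "alg_closed TYPE('f)" and "finite A" "zariski_dense I (\<Union>i\<in>A. S i)"
  shows "\<exists>i\<in>A. zariski_dense I (S i)"
  using assms(2,3)
proof (induction A rule: finite_induct)
  case empty
  then show ?case using zariski_dense_nonempty by auto
next
  case (insert i A)
  then show ?case using zariski_dense_Un[OF cl, of I "S i" "\<Union>i\<in>A. S i"] by auto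
qed

text \<open>The index \<^term>\<open>None\<close> plays the role of the limit point \<^term>\<open>p\<close>, the other indices that of the
  points of \<^term>\<open>S\<close>: density says precisely that evaluation at \<^term>\<open>p\<close> is determined by the
  restriction of a polynomial function to \<^term>\<open>S\<close>.\<close>
lemma dense_limit_algebra:
  fixes p :: "'v \<Rightarrow> 'f::field"
  assumes cl: "alg_closed TYPE('f)" and S: "zariski_dense I S" and p: "p \<in> affine_points I"
  obtains H and r :: "('v \<Rightarrow> 'f) option \<Rightarrow> 'v \<Rightarrow> 'f"
  where "maximal_limit_algebra None H" "r None = p" "\<And>s. s \<noteq> None \<Longrightarrow> r s \<in> S"
    "\<And>v. (\<lambda>s. r s v) \<in> H"
proof -
  obtain s0 where s0: "s0 \<in> S" using zariski_dense_nonempty[OF S] by (auto simp: ex_in_conv[symmetric])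
  \<comment> \<open>The index type also contains \<open>Some s\<close> for points \<open>s\<close>
    outside \<open>S\<close>; these are sent to \<open>s0\<close>, so that every index other than
    \<open>None\<close> denotes a point of \<open>S\<close>.\<close>
  define r where "r = (\<lambda>t. case t of None \<Rightarrow> p | Some s \<Rightarrow> if s \<in> S then s else s0)"
  have rS: "r s \<in> S" if "s \<noteq> None" for s using that s0 by (auto simp: r_def)
  have rp: "r None = p" by (simp add: r_def)
  define H0 where "H0 = (\<lambda>f t. f (r t)) ` poly_funs I"
  have H0_I: "(\<lambda>t. f (r t)) \<in> H0" if "f \<in> poly_funs I" for f
    unfolding H0_def using that by (rule imageI)
  have "limit_algebra None H0"
  proof
    show "(\<lambda>_. c) \<in> H0" for c
      using H0_I[OF pf_const[of c]] by simp
    fix f g assume "f \<in> H0"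
    then obtain F where F: "f = (\<lambda>t. F (r t))" "F \<in> poly_funs I"
      unfolding H0_def by (rule imageE)
    { assume "g \<in> H0"
      then obtain K where K: "g = (\<lambda>t. K (r t))" "K \<in> poly_funs I"
        unfolding H0_def by (rule imageE)
      show "(\<lambda>s. f s + g s) \<in> H0" using H0_I[OF pf_add[OF F(2) K(2)]] F K by simp
      show "(\<lambda>s. f s * g s) \<in> H0" using H0_I[OF pf_mult[OF F(2) K(2)]] F K by simp }
    assume z: "\<And>s. s \<noteq> None \<Longrightarrow> f s = 0"
    have "F s = 0" if "s \<in> S" for s
      using z[of "Some s"] that F by (simp add: r_def)
    then have "F p = 0" by (rule zariski_denseD[OF S F(2) _ p])
    then show "f None = 0" using F rp by simp
  qed
  then obtain H where H: "H0 \<subseteq> H" "maximal_limit_algebra None H"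
    by (rule maximal_limit_algebra_exists[OF cl])
  have "(\<lambda>s. r s v) \<in> H" for v
  proof (cases "v \<in> I")
    case True
    then show ?thesis using H0_I[OF pf_var] H(1) by blast
  next
    case False
    have "r s \<in> affine_points I" for s
      using rS[of s] rp p S by (cases "s = None") (auto simp: zariski_dense_def)
    then have "(\<lambda>s. r s v) = (\<lambda>_. 0)" using False by (auto simp: affine_points_def)
    moreover have "limit_algebra None H" using H(2) by (simp add: maximal_limit_algebra_def)
    ultimately show ?thesis using limit_algebra.const by metis
  qed
  then show ?thesis using that[of H r] H(2) rp rS by blast
qed

section \<open>Columns of a generic matrix span\<close>

lemma exists_annihilator:
  fixes Y :: "(nat \<Rightarrow> 'f::field) set"
  assumes Y: "Y \<subseteq> affine_points {0..<k}" and ns: "fs.span Y \<noteq> affine_points {0..<k}"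
  shows "\<exists>w. (\<exists>i\<in>{0..<k}. w i \<noteq> 0) \<and> (\<forall>y\<in>Y. (\<Sum>i\<in>{0..<k}. w i * y i) = 0)"
proof -
  interpret p: vector_space_pair "fscale :: 'f \<Rightarrow> (nat \<Rightarrow> 'f) \<Rightarrow> _" "(*) :: 'f \<Rightarrow> 'f \<Rightarrow> 'f"
    by unfold_locales (auto simp: algebra_simps)
  have "fs.subspace (affine_points {0..<k} :: (nat \<Rightarrow> 'f) set)"
    by (auto simp: fs.subspace_def affine_points_def fscale_def)
  then have "fs.span Y \<subseteq> affine_points {0..<k}" using Y by (rule fs.span_minimal[rotated])
  then obtain v where v: "v \<in> affine_points {0..<k}" "v \<notin> fs.span Y" using ns by blast
  obtain B where B: "B \<subseteq> Y" "fs.independent B" "Y \<subseteq> fs.span B"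
    by (rule fs.maximal_independent_subset)
  have "fs.span B \<subseteq> fs.span Y" using B(1) by (rule fs.span_mono)
  then have vB: "v \<notin> fs.span B" using v(2) by blast
  then have "v \<notin> B" using fs.span_base by blast
  \<comment> \<open>A functional that kills \<open>Y\<close> and is 1 at the missed vector
    \<open>v\<close>; its values on unit vectors are the coefficients sought.\<close>
  obtain g where g: "Vector_Spaces.linear fscale (*) g" "\<forall>x\<in>insert v B. g x = (if x = v then 1 else 0)"
    using p.linear_independent_extend[OF fs.independent_insertI[OF vB B(2)],
        of "\<lambda>x. if x = v then 1 else 0"] by (elim exE conjE)
  define unit :: "nat \<Rightarrow> nat \<Rightarrow> 'f" where "unit i = (\<lambda>j. if j = i then 1 else 0)" for i
  have expand: "g x = (\<Sum>i\<in>{0..<k}. g (unit i) * x i)" if x: "x \<in> affine_points {0..<k}" for x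
  proof -
    have "x j = (\<Sum>i\<in>{0..<k}. fscale (x i) (unit i)) j" for j
    proof -
      have "(\<Sum>i\<in>A. F i) j = (\<Sum>i\<in>A. F i j)" for A :: "nat set" and F :: "nat \<Rightarrow> nat \<Rightarrow> 'f"
        by (induction A rule: infinite_finite_induct) auto
      then have "(\<Sum>i\<in>{0..<k}. fscale (x i) (unit i)) j = (\<Sum>i\<in>{0..<k}. if i = j then x i else 0)"
        by (simp add: fscale_def unit_def eq_commute[of j] if_distrib cong: if_cong sum.cong_simp)
      then show ?thesis using x by (auto simp: affine_points_def)
    qed
    then have "x = (\<Sum>i\<in>{0..<k}. fscale (x i) (unit i))" by blast
    then have "g x = g (\<Sum>i\<in>{0..<k}. fscale (x i) (unit i))" by (rule arg_cong)
    then show ?thesis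
      using g(1) by (simp add: p.linear_sum p.linear_scale mult.commute)
  qed
  have "g v = 1" using g(2) by simp
  then have "(\<Sum>i\<in>{0..<k}. g (unit i) * v i) \<noteq> 0" using expand[OF v(1)] by simp
  then have "\<exists>i\<in>{0..<k}. g (unit i) \<noteq> 0" by (metis (no_types, lifting) mult_zero_left sum.neutral)
  moreover have "g y = 0" if "y \<in> Y" for y
  proof (rule p.linear_eq_0_on_span[OF g(1)])
    show "y \<in> fs.span B" using that B(3) by blast
    show "g x = 0" if "x \<in> B" for x using g(2) that \<open>v \<notin> B\<close> by auto
  qed
  ultimately show ?thesis
    using expand Y by (intro exI[of _ "\<lambda>i. g (unit i)"]) (auto simp: subset_iff)
qed

text \<open>Failure to span passes to limits: nonzero row vectors annihilating the columns in
  \<open>X\<close> can be normalized to have a nonzero limit, which annihilates the columns of the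
  limit matrix. This is absurd for \<open>p\<close>, whose columns at the points \<open>e i\<close>
  of \<open>X\<close> are the unit vectors.\<close>

lemma nonspanning_not_dense:
  fixes G :: "('g, 'b) monoid_scheme"
  assumes cl: "alg_closed TYPE('f::field)" and X: "finite X" "X \<subseteq> carrier G" "k \<le> card X"
  shows "\<not> zariski_dense (mat_index k G)
    {M :: nat \<times> 'g \<Rightarrow> 'f. M \<in> affine_points (mat_index k G) \<and>
      fs.span (column M ` X) \<noteq> affine_points {0..<k}}"
    (is "\<not> zariski_dense ?I ?N")
proof
  assume dense: "zariski_dense ?I ?N"
  obtain e where e: "e ` {0..<k} \<subseteq> X" "inj_on e {0..<k}"
    using card_le_inj[of "{0..<k}" X] X by auto
  define p :: "nat \<times> 'g \<Rightarrow> 'f" where "p = (\<lambda>(i, x). if i < k \<and> x = e i then 1 else 0)"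
  have "e i \<in> carrier G" if "i < k" for i
    using subsetD[OF subset_trans[OF e(1) X(2)], of "e i"] that by simp
  then have p: "p \<in> affine_points ?I"
    by (auto simp: affine_points_def p_def mat_index_def)
  obtain H and r :: "(nat \<times> 'g \<Rightarrow> 'f) option \<Rightarrow> nat \<times> 'g \<Rightarrow> 'f" where
    H: "maximal_limit_algebra None H" "r None = p" "\<And>s. s \<noteq> None \<Longrightarrow> r s \<in> ?N" "\<And>v. (\<lambda>s. r s v) \<in> H"
    by (rule dense_limit_algebra[OF cl dense p]) (rule that)
  interpret maximal_limit_algebra None H by (rule H(1))
  have "\<exists>w. s \<noteq> None \<longrightarrow> (\<exists>i\<in>{0..<k}. w i \<noteq> 0) \<and> (\<forall>x\<in>X. (\<Sum>i\<in>{0..<k}. w i * r s (i, x)) = 0)" for s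
  proof (cases "s = None")
    case False
    have "column (r s) ` X \<subseteq> affine_points {0..<k}"
      using H(3)[OF False] by (auto simp: affine_points_def mat_index_def column_def)
    moreover have "fs.span (column (r s) ` X) \<noteq> affine_points {0..<k}" using H(3)[OF False] by simp
    ultimately show ?thesis
      using exists_annihilator[of "column (r s) ` X" k] by (auto simp: column_def)
  qed simp
  then have "\<forall>s. \<exists>w. s \<noteq> None \<longrightarrow> (\<exists>i\<in>{0..<k}. w i \<noteq> 0) \<and> (\<forall>x\<in>X. (\<Sum>i\<in>{0..<k}. w i * r s (i, x)) = 0)"
    by (rule allI)
  from choice[OF this] obtain w where w: "\<And>s. s \<noteq> None \<Longrightarrow> \<exists>i\<in>{0..<k}. w s i \<noteq> 0"
    "\<And>s x. s \<noteq> None \<Longrightarrow> x \<in> X \<Longrightarrow> (\<Sum>i\<in>{0..<k}. w s i * r s (i, x)) = 0"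
    by auto
  obtain l b i0 where b: "\<And>i. i \<in> {0..<k} \<Longrightarrow> b i \<in> H"
    "\<And>i s. i \<in> {0..<k} \<Longrightarrow> s \<noteq> None \<Longrightarrow> b i s = l s * w s i" "i0 \<in> {0..<k}" "b i0 None = 1"
    by (rule normalization[OF finite_atLeastLessThan, where c = "\<lambda>i s. w s i", OF w(1)])
      (assumption, rule that)
  have x0: "e i0 \<in> X" using e(1) b(3) by blast
  have "(\<Sum>i\<in>{0..<k}. b i None * r None (i, e i0)) = 0"
  proof (rule limit_zero[of "\<lambda>s. \<Sum>i\<in>{0..<k}. b i s * r s (i, e i0)"])
    show "(\<lambda>s. \<Sum>i\<in>{0..<k}. b i s * r s (i, e i0)) \<in> H"
      by (intro sum mult b(1) H(4)) auto
    fix s :: "(nat \<times> 'g \<Rightarrow> 'f) option" assume s: "s \<noteq> None"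
    have "(\<Sum>i\<in>{0..<k}. b i s * r s (i, e i0)) = l s * (\<Sum>i\<in>{0..<k}. w s i * r s (i, e i0))"
      unfolding sum_distrib_left by (intro sum.cong refl) (simp only: b(2)[OF _ s] mult.assoc)
    then show "(\<Sum>i\<in>{0..<k}. b i s * r s (i, e i0)) = 0" by (simp add: w(2)[OF s x0])
  qed
  moreover have "(\<Sum>i\<in>{0..<k}. b i None * r None (i, e i0)) = (\<Sum>i\<in>{0..<k}. if i = i0 then b i0 None else 0)"
    unfolding H(2) using e(2) b(3)
    by (intro sum.cong) (auto simp: p_def inj_on_def)
  ultimately show False using b(3,4) by simp
qed

section \<open>Comparison of rho(L) with the number of translates of L through a point\<close>

lemma components_disjoint:
  assumes "C \<in> components G g1 g2 L" "D \<in> components G g1 g2 L" "C \<noteq> D"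
  shows "C \<inter> D = {}"
proof (rule ccontr)
  let ?A = "(adj_rel G g1 g2 L)\<^sup>*"
  assume "C \<inter> D \<noteq> {}"
  then obtain x where x: "x \<in> C" "x \<in> D" by blast
  obtain u w where u: "C = {v \<in> fst L. (u, v) \<in> ?A}" and w: "D = {v \<in> fst L. (w, v) \<in> ?A}"
    using assms(1,2) unfolding components_def by blast
  have "sym (adj_rel G g1 g2 L)" by (auto simp: sym_def adj_rel_def)
  then have sym: "sym ?A" by (rule sym_rtrancl)
  have ux: "(u, x) \<in> ?A" and wx: "(w, x) \<in> ?A" using x u w by simp_all
  have "(u, w) \<in> ?A" using ux symD[OF sym wx] by (rule rtrancl_trans)
  moreover have "(w, u) \<in> ?A" using wx symD[OF sym ux] by (rule rtrancl_trans)
  ultimately have "(u, v) \<in> ?A \<longleftrightarrow> (w, v) \<in> ?A" for v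
    using rtrancl_trans by metis
  then show False using u w assms(3) by simp
qed

text \<open>An edge is determined by its label and its tail, so a component \<open>C\<close> has at
  most \<open>card C\<close> edges of the other label. Hence its contribution to rho is at most its
  number of edges labelled \<open>i\<close>, and these add up over the disjoint components.\<close>

lemma rho_le_card_edges:
  assumes "finite (carrier G)" and L: "is_subgraph G g1 g2 L" and i: "i \<in> {1, 2}"
  shows "rho G g1 g2 L \<le> card {h. (h, i) \<in> snd L}"
proof -
  define E where "E j = {h. (h, j) \<in> snd L}" for j
  have EV: "E j \<subseteq> fst L" for j
    using L by (force simp: is_subgraph_def E_def cay_tail_def)
  have V: "fst L \<subseteq> carrier G" using L by (simp add: is_subgraph_def)
  then have finV: "finite (fst L)" using assms(1) finite_subset by blast
  have comp: "C \<subseteq> fst L" if "C \<in> components G g1 g2 L" for C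
    using that by (auto simp: components_def)
  then have "components G g1 g2 L \<subseteq> Pow (fst L)" by blast
  then have finC: "finite (components G g1 g2 L)"
    using finV finite_subset finite_Pow_iff by metis
  have le: "nat (int (card {e \<in> snd L. cay_tail e \<in> C}) - int (card C)) \<le> card (E i \<inter> C)"
    if C: "C \<in> components G g1 g2 L" for C
  proof -
    have finC: "finite C" using comp[OF C] finV finite_subset by blast
    have sub: "{e \<in> snd L. cay_tail e \<in> C} \<subseteq> (\<lambda>h. (h, 1)) ` (E 1 \<inter> C) \<union> (\<lambda>h. (h, 2)) ` (E 2 \<inter> C)"
      using L by (auto simp: E_def is_subgraph_def cay_edges_def cay_tail_def)
    have "card {e \<in> snd L. cay_tail e \<in> C}
        \<le> card ((\<lambda>h. (h, 1 :: nat)) ` (E 1 \<inter> C) \<union> (\<lambda>h. (h, 2)) ` (E 2 \<inter> C))"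
      using finC by (intro card_mono sub) auto
    also have "\<dots> \<le> card ((\<lambda>h. (h, 1 :: nat)) ` (E 1 \<inter> C)) + card ((\<lambda>h. (h, 2 :: nat)) ` (E 2 \<inter> C))"
      by (rule card_Un_le)
    also have "\<dots> \<le> card (E 1 \<inter> C) + card (E 2 \<inter> C)"
      using finC by (intro add_mono card_image_le) auto
    finally have "card {e \<in> snd L. cay_tail e \<in> C} \<le> card (E 1 \<inter> C) + card (E 2 \<inter> C)" .
    moreover have "card (E j \<inter> C) \<le> card C" for j
      using finC by (intro card_mono) auto
    from this[of 1] this[of 2] have "card (E 1 \<inter> C) \<le> card C" "card (E 2 \<inter> C) \<le> card C" .
    ultimately show ?thesis using i by auto
  qed
  have "rho G g1 g2 L \<le> (\<Sum>C\<in>components G g1 g2 L. card (E i \<inter> C))"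
    unfolding rho_def by (rule sum_mono) (rule le)
  also have "\<dots> = card (\<Union>C\<in>components G g1 g2 L. E i \<inter> C)"
  proof (rule card_UN_disjoint[symmetric, OF finC])
    show "\<forall>C\<in>components G g1 g2 L. finite (E i \<inter> C)"
      using finite_subset[OF EV finV] by blast
    show "\<forall>C\<in>components G g1 g2 L. \<forall>D\<in>components G g1 g2 L. C \<noteq> D \<longrightarrow> (E i \<inter> C) \<inter> (E i \<inter> D) = {}"
    proof (intro ballI impI)
      fix C D assume "C \<in> components G g1 g2 L" "D \<in> components G g1 g2 L" "C \<noteq> D"
      from components_disjoint[OF this] show "(E i \<inter> C) \<inter> (E i \<inter> D) = {}" by blast
    qed
  qed
  also have "\<dots> \<le> card (E i)"
    using finite_subset[OF EV finV] by (intro card_mono) auto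
  finally show ?thesis by (simp add: E_def)
qed

text \<open>Right translation by \<open>inv h \<otimes> v\<close> moves \<open>h\<close> to
  \<open>v\<close>, so every edge \<open>(h, i)\<close> of \<open>L\<close> yields a translate
  through the edge \<open>(v, i)\<close> and through its tail \<open>v\<close>. Different
  \<open>h\<close> give different translates. For a vertex \<open>P\<close> either label will
  do.\<close>

lemma rho_le_card_GL:
  fixes G (structure)
  assumes "group G" "finite (carrier G)" and L: "is_subgraph G g1 g2 L" and P: "P \<in> gpoints G"
  shows "rho G g1 g2 L \<le> card (GL G L P)"
proof -
  interpret group G by fact
  have finGL: "finite (GL G L P)"
    using assms(2) by (simp add: GL_def)
  have EV: "h \<in> fst L \<and> h \<in> carrier G" if "(h, i) \<in> snd L" for h i
    using L that by (force simp: is_subgraph_def cay_tail_def)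
  obtain v i where v: "v \<in> carrier G" "i \<in> {1, 2}" "P = Inl v \<or> P = Inr (v, i)"
    using P by (force simp: gpoints_def cay_edges_def)
  have "rho G g1 g2 L \<le> card {h. (h, i) \<in> snd L}"
    using rho_le_card_edges[OF assms(2) L v(2)] .
  also have "\<dots> \<le> card (GL G L P)"
  proof (rule card_inj_on_le[OF _ _ finGL])
    show "inj_on (\<lambda>h. inv h \<otimes> v) {h. (h, i) \<in> snd L}"
    proof (rule inj_onI)
      fix h h' assume h: "h \<in> {h. (h, i) \<in> snd L}" "h' \<in> {h. (h, i) \<in> snd L}"
        and eq: "inv h \<otimes> v = inv h' \<otimes> v"
      have hc: "h \<in> carrier G" "h' \<in> carrier G" using EV h by blast+
      then have "inv h = inv h'" using eq v(1) by simp
      then show "h = h'" using hc by (metis inv_inv)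
    qed
    show "(\<lambda>h. inv h \<otimes> v) ` {h. (h, i) \<in> snd L} \<subseteq> GL G L P"
    proof
      fix x assume "x \<in> (\<lambda>h. inv h \<otimes> v) ` {h. (h, i) \<in> snd L}"
      then obtain h where h: "(h, i) \<in> snd L" "x = inv h \<otimes> v" by blast
      have hV: "h \<in> fst L" "h \<in> carrier G" using EV h by blast+
      then have x: "x \<in> carrier G" "v = h \<otimes> x"
        using h v(1) by (simp_all add: m_assoc[symmetric])
      from v(3) show "x \<in> GL G L P"
      proof
        assume "P = Inl v"
        then show ?thesis
          using x hV(1) by (auto simp: GL_def in_graph_def translate_def)
      next
        assume "P = Inr (v, i)"
        moreover have "(v, i) \<in> (\<lambda>(g, i). (g \<otimes> x, i)) ` snd L"
          using h(1) x(2) by force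
        ultimately show ?thesis
          using x(1) by (simp add: GL_def in_graph_def translate_def)
      qed
    qed
  qed
  finally show ?thesis .
qed

text \<open>The matrices that are not L-surjective form a finite union, over the points
  \<open>P\<close>, of sets that are not dense, so by irreducibility the remaining matrices are
  dense.\<close>

lemma L_surjective_dense:
  fixes G :: "('g, 'b) monoid_scheme"
  assumes cl: "alg_closed TYPE('f::field)" and G: "group G" "finite (carrier G)"
    and L: "is_subgraph G g1 g2 L" and k: "k \<le> rho G g1 g2 L"
  shows "zariski_dense (mat_index k G)
    {M :: nat \<times> 'g \<Rightarrow> 'f. M \<in> affine_points (mat_index k G) \<and> L_surjective G L k M}"
    (is "zariski_dense ?I ?S")
proof -
  define N :: "'g + 'g \<times> nat \<Rightarrow> (nat \<times> 'g \<Rightarrow> 'f) set" where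
    "N P = {M. M \<in> affine_points ?I \<and> fs.span (column M ` GL G L P) \<noteq> affine_points {0..<k}}" for P
  have fin: "finite (gpoints G)"
    using G(2) by (simp add: gpoints_def cay_edges_def)
  have nd: "\<not> zariski_dense ?I (N P)" if P: "P \<in> gpoints G" for P
    unfolding N_def
  proof (rule nonspanning_not_dense[OF cl])
    show "finite (GL G L P)" "GL G L P \<subseteq> carrier G" using G(2) by (auto simp: GL_def)
    show "k \<le> card (GL G L P)" using rho_le_card_GL[OF G L P] k by simp
  qed
  have "affine_points ?I = ?S \<union> (\<Union>P\<in>gpoints G. N P)"
    by (auto simp: L_surjective_def N_def)
  then have "zariski_dense ?I (?S \<union> (\<Union>P\<in>gpoints G. N P))"
    using zariski_dense_affine[of ?I] by simp
  then consider "zariski_dense ?I ?S" | "zariski_dense ?I (\<Union>P\<in>gpoints G. N P)"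
    using zariski_dense_Un[OF cl] by blast
  then show ?thesis
    using zariski_dense_UN[OF cl fin, of ?I N] nd by cases auto
qed

section \<open>Maximum excess\<close>

locale subspace_sheaf =
  fixes G :: "('g, 'b) monoid_scheme" and g1 g2 :: 'g
    and F :: "'g + 'g \<times> nat \<Rightarrow> ('g \<Rightarrow> 'f::field) set"
  assumes finite_carrier: "finite (carrier G)"
    and subspace_value: "fs.subspace (F P)"
    and value_support: "a \<in> F P \<Longrightarrow> x \<notin> carrier G \<Longrightarrow> a x = 0"
begin

definition excess :: "('g \<Rightarrow> 'g \<Rightarrow> 'f) set \<Rightarrow> int" where
  "excess U = int (fs2.dim (Gamma_ht G g1 g2 F U)) - int (fs2.dim U)"

lemma sheaf_FV_supported: "sheaf_FV G F \<subseteq> supported (carrier G \<times> carrier G)"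
proof
  fix p assume p: "p \<in> sheaf_FV G F"
  have "p v x = 0" if "(v, x) \<notin> carrier G \<times> carrier G" for v x
  proof (cases "v \<in> carrier G")
    case True
    then have "p v \<in> F (Inl v)" "x \<notin> carrier G" using p that by (auto simp: sheaf_FV_def)
    then show ?thesis by (rule value_support)
  next
    case False
    then have "p v = 0" using p by (simp add: sheaf_FV_def)
    then show ?thesis by simp
  qed
  then show "p \<in> supported (carrier G \<times> carrier G)" by (simp add: supported_def)
qed

lemma Gamma_ht_supported: "Gamma_ht G g1 g2 F U \<subseteq> supported (cay_edges G \<times> carrier G)"
proof
  fix w assume w: "w \<in> Gamma_ht G g1 g2 F U"
  have "w e x = 0" if "(e, x) \<notin> cay_edges G \<times> carrier G" for e x
  proof (cases "e \<in> cay_edges G")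
    case True
    then have "w e \<in> F (Inr e)" "x \<notin> carrier G" using w that by (auto simp: Gamma_ht_def)
    then show ?thesis by (rule value_support)
  next
    case False
    then have "w e = 0" using w by (cases e) (simp add: Gamma_ht_def)
    then show ?thesis by simp
  qed
  then show "w \<in> supported (cay_edges G \<times> carrier G)" by (simp add: supported_def)
qed

lemma finite_vertex_index: "finite (carrier G \<times> carrier G)"
  and finite_edge_index: "finite (cay_edges G \<times> carrier G)"
  using finite_carrier by (auto simp: cay_edges_def)

lemma sheaf_FV_finite_span:
  obtains T where "finite T" "sheaf_FV G F \<subseteq> fs2.span T" "card T \<le> card (carrier G \<times> carrier G)"
proof -
  obtain T :: "('g \<Rightarrow> 'g \<Rightarrow> 'f) set" where T: "finite T"
    "supported (carrier G \<times> carrier G) \<subseteq> fs2.span T" "card T \<le> card (carrier G \<times> carrier G)"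
    by (rule supported_finite_span[OF finite_vertex_index])
  show ?thesis
    by (rule that[OF T(1) subset_trans[OF sheaf_FV_supported T(2)] T(3)])
qed

lemma Gamma_ht_finite_span:
  obtains T where "finite T" "\<And>U. Gamma_ht G g1 g2 F U \<subseteq> fs2.span T"
    "card T \<le> card (cay_edges G \<times> carrier G)"
proof -
  obtain T :: "('g \<times> nat \<Rightarrow> 'g \<Rightarrow> 'f) set" where T: "finite T"
    "supported (cay_edges G \<times> carrier G) \<subseteq> fs2.span T" "card T \<le> card (cay_edges G \<times> carrier G)"
    by (rule supported_finite_span[OF finite_edge_index])
  show ?thesis
    by (rule that[OF T(1) subset_trans[OF Gamma_ht_supported T(2)] T(3)])
qed

lemma subspace_sheaf_FV: "fs2.subspace (sheaf_FV G F)"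
proof (rule fs2.subspaceI)
  show "0 \<in> sheaf_FV G F"
    using fs.subspace_0[OF subspace_value] by (simp add: sheaf_FV_def)
  show "p + q \<in> sheaf_FV G F" if "p \<in> sheaf_FV G F" "q \<in> sheaf_FV G F" for p q
    using that fs.subspace_add[OF subspace_value] by (simp add: sheaf_FV_def)
  show "fscale2 c p \<in> sheaf_FV G F" if "p \<in> sheaf_FV G F" for c p
    using that fs.subspace_scale[OF subspace_value] by (simp add: sheaf_FV_def fscale2_def)
qed

lemma place_add: "place v (a + b) = place v a + (place v b :: 'g \<Rightarrow> 'g \<Rightarrow> 'f)"
  by (auto simp: place_def)

lemma place_scale: "place v (fscale c a) = fscale2 c (place v a :: 'g \<Rightarrow> 'g \<Rightarrow> 'f)"
  by (auto simp: place_def fscale2_def fscale_def fun_eq_iff)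

lemma place_zero: "place v 0 = (0 :: 'g \<Rightarrow> 'g \<Rightarrow> 'f)"
  by (auto simp: place_def)

lemma subspace_Gamma_ht:
  assumes U: "fs2.subspace U"
  shows "fs2.subspace (Gamma_ht G g1 g2 F U)"
proof (rule fs2.subspaceI)
  show "0 \<in> Gamma_ht G g1 g2 F U"
    using fs.subspace_0[OF subspace_value] fs2.subspace_0[OF U]
    by (simp add: Gamma_ht_def place_zero)
  show "p + q \<in> Gamma_ht G g1 g2 F U" if "p \<in> Gamma_ht G g1 g2 F U" "q \<in> Gamma_ht G g1 g2 F U" for p q
    using that fs.subspace_add[OF subspace_value] fs2.subspace_add[OF U]
    by (simp add: Gamma_ht_def place_add)
  show "fscale2 c p \<in> Gamma_ht G g1 g2 F U" if "p \<in> Gamma_ht G g1 g2 F U" for c p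
    using that fs.subspace_scale[OF subspace_value] fs2.subspace_scale[OF U]
    by (simp add: Gamma_ht_def place_scale fscale2_def[of c p])
qed

lemma Gamma_ht_mono: "U \<subseteq> U' \<Longrightarrow> Gamma_ht G g1 g2 F U \<subseteq> Gamma_ht G g1 g2 F U'"
  unfolding Gamma_ht_def by blast

lemma Gamma_ht_Int: "Gamma_ht G g1 g2 F (U \<inter> U') = Gamma_ht G g1 g2 F U \<inter> Gamma_ht G g1 g2 F U'"
  unfolding Gamma_ht_def by blast

text \<open>The dimension of \<open>U\<close> is modular. Head-tail sections commute with
  intersections, but those of a sum only contain the sum of those of the summands, which gives the
  inequality.\<close>

lemma excess_supermodular:
  assumes U: "fs2.subspace U" "U \<subseteq> sheaf_FV G F" and U': "fs2.subspace U'" "U' \<subseteq> sheaf_FV G F"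
  shows "excess U + excess U' \<le> excess (U \<inter> U') + excess {x + y |x y. x \<in> U \<and> y \<in> U'}"
proof -
  let ?S = "{x + y |x y. x \<in> U \<and> y \<in> U'}"
  let ?G = "Gamma_ht G g1 g2 F"
  obtain T where T: "finite T" "sheaf_FV G F \<subseteq> fs2.span T"
    by (rule sheaf_FV_finite_span)
  have d1: "fs2.dim ?S + fs2.dim (U \<inter> U') = fs2.dim U + fs2.dim U'"
    by (rule fs2.dim_sums_Int_finite[OF T(1) subset_trans[OF U(2) T(2)] subset_trans[OF U'(2) T(2)] U(1) U'(1)])
  obtain T' where T': "finite T'" "\<And>U. ?G U \<subseteq> fs2.span T'"
    by (rule Gamma_ht_finite_span) (rule that)
  have d2: "fs2.dim {x + y |x y. x \<in> ?G U \<and> y \<in> ?G U'} + fs2.dim (?G U \<inter> ?G U') = fs2.dim (?G U) + fs2.dim (?G U')"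
    by (rule fs2.dim_sums_Int_finite[OF T'(1) T'(2) T'(2) subspace_Gamma_ht[OF U(1)] subspace_Gamma_ht[OF U'(1)]])
  have "U \<subseteq> ?S"
  proof
    fix x assume "x \<in> U"
    then show "x \<in> ?S" using fs2.subspace_0[OF U'(1)]
      by (intro CollectI exI[of _ x] exI[of _ 0]) simp
  qed
  moreover have "U' \<subseteq> ?S"
  proof
    fix x assume "x \<in> U'"
    then show "x \<in> ?S" using fs2.subspace_0[OF U(1)]
      by (intro CollectI exI[of _ 0] exI[of _ x]) simp
  qed
  ultimately have sub: "?G U \<subseteq> ?G ?S" "?G U' \<subseteq> ?G ?S"
    by (simp_all only: Gamma_ht_mono)
  have SS: "fs2.subspace (?G ?S)"
    by (intro subspace_Gamma_ht fs2.subspace_sums U U')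
  have "{x + y |x y. x \<in> ?G U \<and> y \<in> ?G U'} \<subseteq> ?G ?S"
  proof
    fix w assume "w \<in> {x + y |x y. x \<in> ?G U \<and> y \<in> ?G U'}"
    then obtain x y where "w = x + y" "x \<in> ?G U" "y \<in> ?G U'" by (elim CollectE exE conjE)
    then show "w \<in> ?G ?S" using fs2.subspace_add[OF SS] sub by (simp add: subset_iff)
  qed
  then have "{x + y |x y. x \<in> ?G U \<and> y \<in> ?G U'} \<subseteq> fs2.span (?G ?S)"
    using fs2.span_superset by (rule subset_trans)
  then have "fs2.dim {x + y |x y. x \<in> ?G U \<and> y \<in> ?G U'} \<le> fs2.dim (?G ?S)"
    by (rule fs2.dim_mono_finite[OF T'])
  then show ?thesis
    using d1 d2 unfolding excess_def Gamma_ht_Int by linarith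
qed

lemma dim_le_vertex_index:
  assumes "U \<subseteq> sheaf_FV G F"
  shows "fs2.dim U \<le> card (carrier G \<times> carrier G)"
proof -
  obtain T where T: "finite T" "sheaf_FV G F \<subseteq> fs2.span T" "card T \<le> card (carrier G \<times> carrier G)"
    by (rule sheaf_FV_finite_span)
  have "fs2.dim U \<le> card T"
    using subset_trans[OF assms T(2)] T(1) by (rule fs2.dim_le_card)
  then show ?thesis using T(3) by simp
qed

lemma dim_Gamma_ht_le: "fs2.dim (Gamma_ht G g1 g2 F U) \<le> card (cay_edges G \<times> carrier G)"
proof -
  obtain T where T: "finite T" "\<And>U. Gamma_ht G g1 g2 F U \<subseteq> fs2.span T"
    "card T \<le> card (cay_edges G \<times> carrier G)"
    by (rule Gamma_ht_finite_span) (rule that)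
  have "fs2.dim (Gamma_ht G g1 g2 F U) \<le> card T"
    using T(2) T(1) by (rule fs2.dim_le_card)
  then show ?thesis using T(3) by simp
qed

lemma max_excess_eq: "max_excess G g1 g2 F = Max {excess U |U. fs2.subspace U \<and> U \<subseteq> sheaf_FV G F}"
  by (simp add: max_excess_def excess_def)

text \<open>There may be infinitely many subspaces, but the excess is an integer between two bounds;
  this is what makes \<open>Max\<close> meaningful.\<close>

lemma finite_excess: "finite {excess U |U. fs2.subspace U \<and> U \<subseteq> sheaf_FV G F}"
proof (rule finite_subset)
  show "{excess U |U. fs2.subspace U \<and> U \<subseteq> sheaf_FV G F}
    \<subseteq> {- int (card (carrier G \<times> carrier G))..int (card (cay_edges G \<times> carrier G))}"
  proof
    fix m assume "m \<in> {excess U |U. fs2.subspace U \<and> U \<subseteq> sheaf_FV G F}"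
    then obtain U where U: "m = excess U" "U \<subseteq> sheaf_FV G F" by (elim CollectE exE conjE)
    show "m \<in> {- int (card (carrier G \<times> carrier G))..int (card (cay_edges G \<times> carrier G))}"
      unfolding U(1) excess_def
      using dim_le_vertex_index[OF U(2)] dim_Gamma_ht_le[of U] by simp
  qed
qed simp

lemma excess_le_max_excess:
  assumes "fs2.subspace U" "U \<subseteq> sheaf_FV G F"
  shows "excess U \<le> max_excess G g1 g2 F"
  unfolding max_excess_eq by (rule Max_ge[OF finite_excess]) (use assms in \<open>intro CollectI exI conjI; simp\<close>)

lemma excess_zero: "U \<subseteq> {0} \<Longrightarrow> excess U = 0"
proof -
  assume U: "U \<subseteq> {0}"
  have "w = 0" if w: "w \<in> Gamma_ht G g1 g2 F U" for w
  proof
    fix e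
    show "w e = 0 e"
    proof (cases "e \<in> cay_edges G")
      case True
      then have "place (cay_tail e) (w e) = (0 :: 'g \<Rightarrow> 'g \<Rightarrow> 'f)"
        using w U by (auto simp: Gamma_ht_def)
      then have "place (cay_tail e) (w e) (cay_tail e) = (0 :: 'g \<Rightarrow> 'g \<Rightarrow> 'f) (cay_tail e)"
        by (rule arg_cong)
      then show ?thesis by (simp add: place_def)
    next
      case False
      then show ?thesis using w by (cases e) (simp add: Gamma_ht_def)
    qed
  qed
  then have "Gamma_ht G g1 g2 F U \<subseteq> fs2.span {}" by auto
  from fs2.dim_le_card[OF this] have "fs2.dim (Gamma_ht G g1 g2 F U) = 0" by simp
  moreover have "U \<subseteq> fs2.span {}" using U by simp
  from fs2.dim_le_card[OF this] have "fs2.dim U = 0" by simp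
  ultimately show ?thesis by (simp add: excess_def)
qed

lemma zero_subspace_sheaf_FV: "{0} \<subseteq> sheaf_FV G F"
  using fs2.subspace_0[OF subspace_sheaf_FV] by simp

lemma max_excess_nonneg: "0 \<le> max_excess G g1 g2 F"
  using excess_le_max_excess[OF fs2.subspace_single_0 zero_subspace_sheaf_FV] excess_zero[of "{0}"]
  by simp

lemma max_excess_attained:
  obtains U where "fs2.subspace U" "U \<subseteq> sheaf_FV G F" "excess U = max_excess G g1 g2 F"
proof -
  let ?E = "{excess U |U. fs2.subspace U \<and> U \<subseteq> sheaf_FV G F}"
  have "excess {0} \<in> ?E"
    using fs2.subspace_single_0 zero_subspace_sheaf_FV by (intro CollectI exI[of _ "{0}"]) simp
  then have "?E \<noteq> {}" by blast
  with finite_excess have "Max ?E \<in> ?E" by (rule Max_in)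
  then obtain U where "Max ?E = excess U" "fs2.subspace U" "U \<subseteq> sheaf_FV G F"
    by (elim CollectE exE conjE)
  then show ?thesis using that max_excess_eq by simp
qed

end

section \<open>Semicontinuity for the sheaves K_M(L) and the effect of a new row\<close>

lemma subspace_sheaf_KML:
  assumes "finite (carrier G)"
  shows "subspace_sheaf G (KML G L k (M :: nat \<times> 'g \<Rightarrow> 'f::field))"
proof
  show "finite (carrier G)" by fact
  show "fs.subspace (KML G L k M P)" for P
    by (auto simp: fs.subspace_def KML_def fscale_def distrib_right sum.distrib mult.assoc
        sum_distrib_left[symmetric])
  show "a x = 0" if "a \<in> KML G L k M P" "x \<notin> carrier G" for a P x
    using that by (auto simp: KML_def GL_def)
qed

text \<open>Membership is given by polynomial equations in the entries of the vector and of the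
  matrix jointly, so it survives when both vary with \<open>s\<close>.\<close>

lemma (in maximal_limit_algebra) KML_limit:
  assumes "finite (carrier G)" and r: "\<And>v. (\<lambda>s. r s v) \<in> H" and a: "\<And>x. (\<lambda>s. a s x) \<in> H"
    and K: "\<And>s. s \<noteq> z \<Longrightarrow> a s \<in> KML G L k (r s) P"
  shows "a z \<in> KML G L k (r z) P"
proof -
  have "a z x = 0" if "x \<notin> GL G L P" for x
    by (rule limit_zero[OF a]) (use K that in \<open>simp add: KML_def\<close>)
  moreover have "(\<Sum>x\<in>carrier G. a z x * r z (i, x)) = 0" if i: "i < k" for i
  proof (rule limit_zero[of "\<lambda>s. \<Sum>x\<in>carrier G. a s x * r s (i, x)"])
    show "(\<lambda>s. \<Sum>x\<in>carrier G. a s x * r s (i, x)) \<in> H"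
      by (intro sum mult assms a r)
    show "(\<Sum>x\<in>carrier G. a s x * r s (i, x)) = 0" if "s \<noteq> z" for s
      using K[OF that] i by (simp add: KML_def)
  qed
  ultimately show ?thesis by (simp add: KML_def)
qed

text \<open>Semicontinuity: a maximizing subspace specializes along a limit algebra without gaining
  dimension, while its head-tail sections do not lose dimension.\<close>
lemma max_excess_lower_bound_closed:
  fixes G :: "('g, 'b) monoid_scheme" and p :: "nat \<times> 'g \<Rightarrow> 'f::field"
  assumes cl: "alg_closed TYPE('f)" and fin: "finite (carrier G)"
    and dense: "zariski_dense (mat_index k G)
      {M :: nat \<times> 'g \<Rightarrow> 'f. M \<in> affine_points (mat_index k G) \<and> m \<le> max_excess G g1 g2 (KML G L k M)}"
    and p: "p \<in> affine_points (mat_index k G)"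
  shows "m \<le> max_excess G g1 g2 (KML G L k p)"
proof -
  let ?FV = "\<lambda>M :: nat \<times> 'g \<Rightarrow> 'f. sheaf_FV G (KML G L k M)"
  let ?Ga = "\<lambda>M :: nat \<times> 'g \<Rightarrow> 'f. Gamma_ht G g1 g2 (KML G L k M)"
  let ?N = "card (carrier G \<times> carrier G)"
  \<comment> \<open>The dimension \<open>d\<close> of the maximizer is fixed so that the limit can
    be compared with constants. Only finitely many \<open>d\<close> occur, so one of the sets
    \<open>S d\<close> is dense.\<close>
  define Q where "Q d M U \<longleftrightarrow> fs2.subspace U \<and> U \<subseteq> ?FV M \<and> fs2.dim U = d \<and>
    int d + m \<le> int (fs2.dim (?Ga M U))" for d M U
  define S where "S d = {M :: nat \<times> 'g \<Rightarrow> 'f. M \<in> affine_points (mat_index k G) \<and> (\<exists>U. Q d M U)}" for d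
  have "zariski_dense (mat_index k G) (\<Union>d\<in>{..?N}. S d)"
  proof (rule zariski_dense_mono[OF dense])
    show "(\<Union>d\<in>{..?N}. S d) \<subseteq> affine_points (mat_index k G)" by (auto simp: S_def)
    show "{M :: nat \<times> 'g \<Rightarrow> 'f. M \<in> affine_points (mat_index k G) \<and> m \<le> max_excess G g1 g2 (KML G L k M)} \<subseteq> (\<Union>d\<in>{..?N}. S d)"
    proof
      fix M :: "nat \<times> 'g \<Rightarrow> 'f" assume "M \<in> {M. M \<in> affine_points (mat_index k G) \<and> m \<le> max_excess G g1 g2 (KML G L k M)}"
      then have M: "M \<in> affine_points (mat_index k G)" "m \<le> max_excess G g1 g2 (KML G L k M)"
        by simp_all
      interpret subspace_sheaf G g1 g2 "KML G L k M" by (rule subspace_sheaf_KML[OF fin])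
      obtain U where U: "fs2.subspace U" "U \<subseteq> ?FV M" "excess U = max_excess G g1 g2 (KML G L k M)"
        by (rule max_excess_attained)
      have "Q (fs2.dim U) M U" using U M(2) by (simp add: Q_def excess_def)
      then have "M \<in> S (fs2.dim U)" using M(1) by (auto simp: S_def)
      then show "M \<in> (\<Union>d\<in>{..?N}. S d)" using dim_le_vertex_index[OF U(2)] by blast
    qed
  qed
  then obtain d where d: "zariski_dense (mat_index k G) (S d)"
    using zariski_dense_UN[OF cl finite_atMost] by blast
  obtain H and r :: "(nat \<times> 'g \<Rightarrow> 'f) option \<Rightarrow> nat \<times> 'g \<Rightarrow> 'f" where
    H: "maximal_limit_algebra None H" "r None = p" "\<And>s. s \<noteq> None \<Longrightarrow> r s \<in> S d" "\<And>v. (\<lambda>s. r s v) \<in> H"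
    by (rule dense_limit_algebra[OF cl d p]) (rule that)
  interpret maximal_limit_algebra None H by (rule H(1))
  have "\<forall>s. \<exists>U. s \<noteq> None \<longrightarrow> Q d (r s) U" using H(3) by (auto simp: S_def)
  from choice[OF this] obtain U where "\<And>s. s \<noteq> None \<Longrightarrow> Q d (r s) (U s)" by auto
  then have U: "\<And>s. s \<noteq> None \<Longrightarrow> fs2.subspace (U s)" "\<And>s. s \<noteq> None \<Longrightarrow> U s \<subseteq> ?FV (r s)"
    "\<And>s. s \<noteq> None \<Longrightarrow> fs2.dim (U s) = d"
    "\<And>s. s \<noteq> None \<Longrightarrow> int d + m \<le> int (fs2.dim (?Ga (r s) (U s)))"
    by (simp_all add: Q_def)
  define V where "V = limit_space U"
  define W where "W s = ?Ga (r s) (U s)" for s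
  interpret p: subspace_sheaf G g1 g2 "KML G L k p" by (rule subspace_sheaf_KML[OF fin])
  have U_supp: "U s \<subseteq> supported (carrier G \<times> carrier G)" if "s \<noteq> None" for s
  proof -
    interpret subspace_sheaf G g1 g2 "KML G L k (r s)" by (rule subspace_sheaf_KML[OF fin])
    show ?thesis using U(2)[OF that] sheaf_FV_supported by (rule subset_trans)
  qed
  have W_supp: "W s \<subseteq> supported (cay_edges G \<times> carrier G)" for s
  proof -
    interpret subspace_sheaf G g1 g2 "KML G L k (r s)" by (rule subspace_sheaf_KML[OF fin])
    show ?thesis unfolding W_def by (rule Gamma_ht_supported)
  qed
  have W_sub: "fs2.subspace (W s)" if "s \<noteq> None" for s
  proof -
    interpret subspace_sheaf G g1 g2 "KML G L k (r s)" by (rule subspace_sheaf_KML[OF fin])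
    show ?thesis unfolding W_def by (rule subspace_Gamma_ht[OF U(1)[OF that]])
  qed
  have V_sub: "fs2.subspace V"
    unfolding V_def by (rule subspace_limit_space) (rule U(1))
  have V_dim: "fs2.dim V \<le> d"
    unfolding V_def by (rule dim_limit_space_le[OF p.finite_vertex_index U_supp]) (simp_all add: U(3))
  have V_FV: "V \<subseteq> ?FV p"
  proof
    fix x assume "x \<in> V"
    then obtain u where u: "x = u None" "\<And>a c. (\<lambda>s. u s a c) \<in> H" "\<And>s. s \<noteq> None \<Longrightarrow> u s \<in> U s"
      unfolding V_def by (rule limit_spaceE) (rule that)
    have uFV: "u s \<in> ?FV (r s)" if "s \<noteq> None" for s
      using U(2)[OF that] u(3)[OF that] by (rule subsetD)
    have "u None v \<in> KML G L k (r None) (Inl v)" if v: "v \<in> carrier G" for v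
      by (rule KML_limit[OF fin H(4) u(2)]) (use uFV v in \<open>simp add: sheaf_FV_def\<close>)
    moreover have "u None v = 0" if v: "v \<notin> carrier G" for v
    proof
      fix c
      have "u s v c = 0" if "s \<noteq> None" for s
        using uFV[OF that] v by (simp add: sheaf_FV_def)
      then have "u None v c = 0" by (rule limit_zero[OF u(2)])
      then show "u None v c = 0 c" by simp
    qed
    ultimately show "x \<in> ?FV p" using u(1) H(2) by (simp add: sheaf_FV_def)
  qed
  have W_lim: "limit_space W \<subseteq> ?Ga p V"
  proof
    fix x assume "x \<in> limit_space W"
    then obtain w where w: "x = w None" "\<And>a c. (\<lambda>s. w s a c) \<in> H" "\<And>s. s \<noteq> None \<Longrightarrow> w s \<in> W s"
      by (rule limit_spaceE) (rule that)
    have "w None e \<in> KML G L k (r None) (Inr e)" if e: "e \<in> cay_edges G" for e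
      by (rule KML_limit[OF fin H(4) w(2)]) (use w(3) e in \<open>simp add: W_def Gamma_ht_def\<close>)
    moreover have place_V: "place v (w None e) \<in> V" if "\<And>s. s \<noteq> None \<Longrightarrow> place v (w s e) \<in> U s" for v e
      unfolding V_def
    proof (rule limit_spaceI[where u = "\<lambda>s. place v (w s e)"])
      show "(\<lambda>s. place v (w s e) a c) \<in> H" for a c
        using w(2)[of e c] const[of 0] by (cases "a = v") (simp_all add: place_def)
    qed (rule that)
    have "place (cay_head G g1 g2 e) (w None e) \<in> V" "place (cay_tail e) (w None e) \<in> V"
      if e: "e \<in> cay_edges G" for e
      by (rule place_V, use w(3) e in \<open>simp add: W_def Gamma_ht_def\<close>)+
    moreover have "w None e = 0" if e: "e \<notin> cay_edges G" for e
    proof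
      fix c
      have "w s e c = 0" if "s \<noteq> None" for s
        using w(3)[OF that] e by (cases e) (simp add: W_def Gamma_ht_def)
      then have "w None e c = 0" by (rule limit_zero[OF w(2)])
      then show "w None e c = 0 c" by simp
    qed
    ultimately show "x \<in> ?Ga p V" using w(1) H(2) by (simp add: Gamma_ht_def)
  qed
  \<comment> \<open>\<open>m\<close> is an arbitrary integer, so \<open>int d + m\<close> may be
    negative; \<open>nat\<close> then makes the bound trivial.\<close>
  have "nat (int d + m) \<le> fs2.dim (limit_space W)"
  proof (rule dim_limit_space_ge[OF p.finite_edge_index W_supp W_sub])
    show "nat (int d + m) \<le> fs2.dim (W s)" if "s \<noteq> None" for s
      using U(4)[OF that] by (simp add: W_def)
  qed
  also have "\<dots> \<le> fs2.dim (?Ga p V)"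
  proof -
    obtain T where T: "finite T" "\<And>U. ?Ga p U \<subseteq> fs2.span T"
      by (rule p.Gamma_ht_finite_span) (rule that)
    show ?thesis
      by (rule fs2.dim_mono_finite[OF T subset_trans[OF W_lim fs2.span_superset]])
  qed
  finally have "m \<le> p.excess V" using V_dim by (simp add: p.excess_def)
  then show ?thesis using p.excess_le_max_excess[OF V_sub V_FV] by simp
qed

text \<open>At the minimum, the set in the definition consists of all L-surjective matrices and is
  dense. Conversely, if the set for some \<open>m\<close> is dense, semicontinuity carries the bound
  to the minimizer \<open>M0\<close>, even if \<open>M0\<close> is not L-surjective.\<close>

lemma gen_max_excess_eq_min:
  fixes G :: "('g, 'b) monoid_scheme"
  assumes cl: "alg_closed TYPE('f::field)" and G: "group G" "finite (carrier G)"
    and L: "is_subgraph G g1 g2 L" and k: "k \<le> rho G g1 g2 L"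
  obtains M0 :: "nat \<times> 'g \<Rightarrow> 'f::field" where "M0 \<in> affine_points (mat_index k G)"
    "gen_max_excess TYPE('f) G g1 g2 L k = max_excess G g1 g2 (KML G L k M0)"
    "\<And>M :: nat \<times> 'g \<Rightarrow> 'f::field. M \<in> affine_points (mat_index k G) \<Longrightarrow>
      max_excess G g1 g2 (KML G L k M0) \<le> max_excess G g1 g2 (KML G L k M)"
proof -
  let ?A = "affine_points (mat_index k G) :: (nat \<times> 'g \<Rightarrow> 'f) set"
  let ?me = "\<lambda>M :: nat \<times> 'g \<Rightarrow> 'f. max_excess G g1 g2 (KML G L k M)"
  have nonneg: "0 \<le> ?me M" for M
    by (rule subspace_sheaf.max_excess_nonneg[OF subspace_sheaf_KML[OF G(2)]])
  have "(\<lambda>_. 0) \<in> ?A" by (simp add: affine_points_def)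
  from ex_has_least_nat[of "\<lambda>M. M \<in> ?A", OF this, of "\<lambda>M. nat (?me M)"]
  obtain M0 where M0: "M0 \<in> ?A" "\<forall>M. M \<in> ?A \<longrightarrow> nat (?me M0) \<le> nat (?me M)"
    by (elim exE conjE)
  have min: "?me M0 \<le> ?me M" if "M \<in> ?A" for M
  proof -
    have "nat (?me M0) \<le> nat (?me M)" using M0(2) that by blast
    then show ?thesis using nonneg[of M] by linarith
  qed
  have "gen_max_excess TYPE('f) G g1 g2 L k = ?me M0"
    unfolding gen_max_excess_def
  proof (rule Greatest_equality)
    have "{M. M \<in> ?A \<and> L_surjective G L k M \<and> ?me M0 \<le> ?me M} = {M. M \<in> ?A \<and> L_surjective G L k M}"
      using min by blast
    then show "zariski_dense (mat_index k G) {M. M \<in> ?A \<and> L_surjective G L k M \<and> ?me M0 \<le> ?me M}"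
      using L_surjective_dense[OF cl G L k] by simp
    fix m assume "zariski_dense (mat_index k G) {M. M \<in> ?A \<and> L_surjective G L k M \<and> m \<le> ?me M}"
    then have "zariski_dense (mat_index k G) {M. M \<in> ?A \<and> m \<le> ?me M}"
      by (rule zariski_dense_mono) auto
    then show "m \<le> ?me M0"
      using M0(1) by (rule max_excess_lower_bound_closed[OF cl G(2)])
  qed
  then show ?thesis using that M0(1) min by blast
qed

text \<open>If the excess is positive, a maximizer of least dimension contains a nonzero vector; a new row
  that does not annihilate this vector lowers the maximum excess, because the maximizers form a
  lattice.\<close>
lemma add_row_decreases_max_excess:
  fixes G :: "('g, 'b) monoid_scheme" and M :: "nat \<times> 'g \<Rightarrow> 'f::field"
  assumes fin: "finite (carrier G)" and M: "M \<in> affine_points (mat_index k G)"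
    and pos: "0 < max_excess G g1 g2 (KML G L k M)"
  obtains M' :: "nat \<times> 'g \<Rightarrow> 'f" where "M' \<in> affine_points (mat_index (Suc k) G)"
    "max_excess G g1 g2 (KML G L (Suc k) M') < max_excess G g1 g2 (KML G L k M)"
proof -
  define m where "m = max_excess G g1 g2 (KML G L k M)"
  interpret K: subspace_sheaf G g1 g2 "KML G L k M" by (rule subspace_sheaf_KML[OF fin])
  define Q where "Q U \<longleftrightarrow> fs2.subspace U \<and> U \<subseteq> sheaf_FV G (KML G L k M) \<and> K.excess U = m" for U
  obtain U0 where "Q U0"
    using K.max_excess_attained unfolding Q_def m_def by metis
  \<comment> \<open>Least dimension is as good as least for inclusion: once
    \<open>U \<inter> W\<close> is also a maximizer, its dimension forces
    \<open>U \<subseteq> W\<close>.\<close>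
  from ex_has_least_nat[of Q, OF this, of fs2.dim] obtain U
    where U: "Q U" and min: "\<And>U'. Q U' \<Longrightarrow> fs2.dim U \<le> fs2.dim U'"
    by (elim exE conjE) blast
  have U1: "fs2.subspace U" "U \<subseteq> sheaf_FV G (KML G L k M)" "K.excess U = m"
    using U by (simp_all add: Q_def)
  have "\<not> U \<subseteq> {0}" using K.excess_zero[of U] U1(3) pos m_def by linarith
  then obtain f where f: "f \<in> U" "f \<noteq> 0" by blast
  then obtain v x where vx: "f v x \<noteq> 0" by (auto simp: fun_eq_iff)
  have "f \<in> supported (carrier G \<times> carrier G)"
    using U1(2) f(1) K.sheaf_FV_supported by blast
  then have vxG: "v \<in> carrier G" "x \<in> carrier G" using vx by (auto simp: supported_def)
  \<comment> \<open>The new row reads off the coordinate \<open>x\<close>, one in which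
    \<open>f v\<close> is nonzero. So \<open>f\<close> violates the new equation.\<close>
  define M' where "M' = (\<lambda>(i, y). if i = k then if y = x then 1 else 0 else M (i, y))"
  have M': "M' \<in> affine_points (mat_index (Suc k) G)"
    using M vxG by (auto simp: affine_points_def mat_index_def M'_def)
  have "a y * M' (k, y) = (if y = x then a x else 0)" for a y
    by (simp add: M'_def)
  then have M'_row: "(\<Sum>y\<in>carrier G. a y * M' (k, y)) = a x" for a
    using vxG(2) fin by simp
  have sub: "KML G L (Suc k) M' P \<subseteq> KML G L k M P" for P
  proof
    fix a assume a: "a \<in> KML G L (Suc k) M' P"
    have "(\<Sum>y\<in>carrier G. a y * M (i, y)) = 0" if i: "i < k" for i
    proof -
      have "(\<Sum>y\<in>carrier G. a y * M' (i, y)) = 0" using a i by (simp add: KML_def)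
      then show ?thesis using i by (simp add: M'_def)
    qed
    then show "a \<in> KML G L k M P" using a by (simp add: KML_def)
  qed
  interpret K': subspace_sheaf G g1 g2 "KML G L (Suc k) M'" by (rule subspace_sheaf_KML[OF fin])
  have "K'.excess W < m" if W: "fs2.subspace W" "W \<subseteq> sheaf_FV G (KML G L (Suc k) M')" for W
  proof (rule ccontr)
    assume "\<not> K'.excess W < m"
    have "sheaf_FV G (KML G L (Suc k) M') \<subseteq> sheaf_FV G (KML G L k M)"
      using sub by (auto simp: sheaf_FV_def)
    then have WM: "W \<subseteq> sheaf_FV G (KML G L k M)" using W(2) by blast
    obtain T where T: "finite T" "\<And>U. Gamma_ht G g1 g2 (KML G L k M) U \<subseteq> fs2.span T"
      by (rule K.Gamma_ht_finite_span) (rule that)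
    have "Gamma_ht G g1 g2 (KML G L (Suc k) M') W \<subseteq> Gamma_ht G g1 g2 (KML G L k M) W"
      using sub by (auto simp: Gamma_ht_def)
    then have "Gamma_ht G g1 g2 (KML G L (Suc k) M') W \<subseteq> fs2.span (Gamma_ht G g1 g2 (KML G L k M) W)"
      using fs2.span_superset by (rule subset_trans)
    then have "fs2.dim (Gamma_ht G g1 g2 (KML G L (Suc k) M') W) \<le> fs2.dim (Gamma_ht G g1 g2 (KML G L k M) W)"
      by (rule fs2.dim_mono_finite[OF T])
    then have "m \<le> K.excess W"
      using \<open>\<not> K'.excess W < m\<close> by (simp add: K.excess_def K'.excess_def)
    let ?S = "{x + y |x y. x \<in> U \<and> y \<in> W}"
    have "?S \<subseteq> sheaf_FV G (KML G L k M)"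
    proof
      fix q assume "q \<in> ?S"
      then obtain a b where "q = a + b" "a \<in> U" "b \<in> W" by (elim CollectE exE conjE)
      then show "q \<in> sheaf_FV G (KML G L k M)"
        using fs2.subspace_add[OF K.subspace_sheaf_FV] U1(2) WM by (simp add: subset_iff)
    qed
    \<comment> \<open>As \<open>U\<close> and \<open>W\<close> both have excess at least
      \<open>m\<close> and their sum has at most \<open>m\<close>, supermodularity leaves at least
      \<open>m\<close> for the intersection.\<close>
    then have "K.excess ?S \<le> m"
      unfolding m_def by (rule K.excess_le_max_excess[OF fs2.subspace_sums[OF U1(1) W(1)]])
    then have "m \<le> K.excess (U \<inter> W)"
      using K.excess_supermodular[OF U1(1,2) W(1) WM] U1(3) \<open>m \<le> K.excess W\<close> by linarith
    moreover have UW: "fs2.subspace (U \<inter> W)" "U \<inter> W \<subseteq> sheaf_FV G (KML G L k M)"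
      using fs2.subspace_inter[OF U1(1) W(1)] U1(2) by blast+
    ultimately have "Q (U \<inter> W)"
      using K.excess_le_max_excess[OF UW] by (simp add: Q_def m_def)
    then have "fs2.dim U \<le> fs2.dim (U \<inter> W)" by (rule min)
    moreover have "f \<notin> W"
    proof
      assume "f \<in> W"
      then have "f v \<in> KML G L (Suc k) M' (Inl v)"
        using W(2) vxG(1) by (auto simp: sheaf_FV_def)
      then have "(\<Sum>y\<in>carrier G. f v y * M' (k, y)) = 0" by (simp add: KML_def)
      then show False using vx M'_row by simp
    qed
    moreover obtain T' where T': "finite T'" "sheaf_FV G (KML G L k M) \<subseteq> fs2.span T'"
      by (rule K.sheaf_FV_finite_span)
    ultimately show False
      using fs2.dim_less_finite[OF T'(1) subset_trans[OF U1(2) T'(2)] UW(1) Int_lower1 f(1)] by simp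
  qed
  then have "max_excess G g1 g2 (KML G L (Suc k) M') < m"
    using K'.max_excess_attained by metis
  then show ?thesis using that[OF M'] by (simp add: m_def)
qed

theorem theorem2:
  fixes G :: "('g, 'b) monoid_scheme" and g1 g2 :: 'g
    and L :: "'g set \<times> ('g \<times> nat) set" and k :: nat
  assumes "alg_closed TYPE('f::field)"
    and "group G" and "finite (carrier G)"
    and "g1 \<in> carrier G" and "g2 \<in> carrier G"
    and "is_subgraph G g1 g2 L"
    and "1 \<le> k" and "k \<le> rho G g1 g2 L"
  shows "gen_max_excess TYPE('f) G g1 g2 L k \<le> gen_max_excess TYPE('f) G g1 g2 L (k - 1) \<and>
    (gen_max_excess TYPE('f) G g1 g2 L k = gen_max_excess TYPE('f) G g1 g2 L (k - 1) \<longleftrightarrow>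
       gen_max_excess TYPE('f) G g1 g2 L k = 0 \<and> gen_max_excess TYPE('f) G g1 g2 L (k - 1) = 0)"
proof -
  obtain l where l: "k = Suc l" using assms(7) by (cases k) auto
  let ?g = "gen_max_excess TYPE('f) G g1 g2 L"
  let ?me = "\<lambda>k (M :: nat \<times> 'g \<Rightarrow> 'f). max_excess G g1 g2 (KML G L k M)"
  obtain M where M: "M \<in> affine_points (mat_index l G)" "?g l = ?me l M"
    by (rule gen_max_excess_eq_min[OF assms(1,2,3,6), of l]) (use assms(8) l in simp_all)
  obtain N where N: "N \<in> affine_points (mat_index k G)" "?g k = ?me k N" "\<And>M'. M' \<in> affine_points (mat_index k G) \<Longrightarrow> ?me k N \<le> ?me k M'"
    by (rule gen_max_excess_eq_min[OF assms(1,2,3,6,8)]) (rule that)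
  have le: "?g k \<le> ?me k M'" if "M' \<in> affine_points (mat_index k G)" for M'
    using N(2) N(3)[OF that] by simp
  \<comment> \<open>Matrices are extended by zero outside their index set, so \<open>M\<close> read
    with \<open>k\<close> rows has a zero last row. The additional equation is void and the sheaf is
    the same.\<close>
  have "M (l, x) = 0" for x
    using M(1) by (simp add: affine_points_def mat_index_def)
  then have "KML G L k M = KML G L l M"
    unfolding l by (auto simp: KML_def fun_eq_iff less_Suc_eq)
  moreover have "M \<in> affine_points (mat_index k G)"
    using M(1) unfolding l by (auto simp: affine_points_def mat_index_def)
  ultimately have mono: "?g k \<le> ?g l" using le[of M] M(2) by simp
  have "?g k < ?g l" if pos: "0 < ?g l"
  proof -
    obtain M' where "M' \<in> affine_points (mat_index (Suc l) G)" "?me (Suc l) M' < ?me l M"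
      by (rule add_row_decreases_max_excess[OF assms(3) M(1)]) (use pos M(2) in simp_all)
    then show ?thesis using le[of M'] M(2) l by simp
  qed
  moreover have "0 \<le> ?g l"
    unfolding M(2) by (rule subspace_sheaf.max_excess_nonneg[OF subspace_sheaf_KML[OF assms(3)]])
  ultimately have "?g k = ?g l \<Longrightarrow> ?g l = 0" by force
  then show ?thesis using mono l by auto
qed

end
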